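(* Let $\varepsilon > 0$, let $k \ge 1$ be a fixed integer and, for each $n \in \mathbb{N}$, let $Y_n = (Y_n^{(1)},\ldots,Y_n^{(k)})$ be a random variable taking values in $\{1,\ldots,n\}^k$ with covariance matrix $A_n$ and real stable probability generating function $P_n$. If there exist a sequence of real numbers $s_n$ with $s_n > n^{\varepsilon}$ and a $k \times k$ matrix $A$ for which $A_n s_n^{-2} \to A$ as $n \to \infty$, then \[ \frac{Y_n - \mathbb{E} Y_n}{s_n} \to \mathcal{N}(0,A) \] in distribution as $n \to \infty$.
   Context: The probability generating function of $Y_n$ is the polynomial $P_n(z_1,\ldots,z_k) = \sum_{0 \le j_1,\ldots,j_k \le n} \mathbb{P}(Y_n = (j_1,\ldots,j_k)) z_1^{j_1}\cdots z_k^{j_k}$. A polynomial $P \in \mathbb{R}[x_1,\ldots,x_k]$ is real stable if each of its roots $\zeta = (\zeta_1,\ldots,\zeta_k) \in \mathbb{C}^k$ has at least one coordinate $\zeta_i$ with imaginary part $\Im(\zeta_i) \le 0$. $\mathcal{N}(0,A)$ denotes the (possibly degenerate) centred Gaussian distribution on $\mathbb{R}^k$ with covariance matrix $A$. *)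

theory Defs
  imports "HOL-Probability.Probability"
begin

section \<open>Real stable polynomials\<close>

text \<open>Polynomials over \<open>\<real>\<close> in variables indexed by the finite type \<open>'k\<close> are represented by
  the functions they induce on \<open>\<complex>\<^sup>k\<close>; this representation is faithful because \<open>\<complex>\<close> is infinite.\<close>

definition real_polynomial :: "(complex ^ 'k \<Rightarrow> complex) \<Rightarrow> bool" where
  "real_polynomial P \<longleftrightarrow>
     (\<exists>(S :: (nat ^ 'k) set) (c :: nat ^ 'k \<Rightarrow> real). finite S \<and>
        (\<forall>z. P z = (\<Sum>j\<in>S. complex_of_real (c j) * (\<Prod>i\<in>UNIV. (z $ i) ^ (j $ i)))))"

definition real_stable :: "(complex ^ 'k \<Rightarrow> complex) \<Rightarrow> bool" where
  "real_stable P \<longleftrightarrow> real_polynomial P \<and> (\<forall>\<zeta>. P \<zeta> = 0 \<longrightarrow> (\<exists>i. Im (\<zeta> $ i) \<le> 0))"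


section \<open>Random vectors\<close>

definition real_vec :: "nat ^ 'k \<Rightarrow> real ^ 'k" where
  "real_vec v = (\<chi> i. real (v $ i))"

text \<open>The parameter \<open>n\<close> is an upper bound for the coordinates of \<open>Y\<close>.\<close>

definition prob_gen_fun ::
  "nat \<Rightarrow> 'a measure \<Rightarrow> ('a \<Rightarrow> nat ^ 'k) \<Rightarrow> complex ^ 'k \<Rightarrow> complex" where
  "prob_gen_fun n M Y z =
     (\<Sum>j\<in>{j. \<forall>i. j $ i \<le> n}.
        complex_of_real (measure M {\<omega> \<in> space M. Y \<omega> = j}) * (\<Prod>i\<in>UNIV. (z $ i) ^ (j $ i)))"

definition mean :: "'a measure \<Rightarrow> ('a \<Rightarrow> real ^ 'k) \<Rightarrow> real ^ 'k" where
  "mean M X = (\<integral>\<omega>. X \<omega> \<partial>M)"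

definition covariance_matrix :: "'a measure \<Rightarrow> ('a \<Rightarrow> real ^ 'k) \<Rightarrow> real ^ 'k ^ 'k" where
  "covariance_matrix M X =
     (\<chi> i j. \<integral>\<omega>. (X \<omega> $ i - mean M X $ i) * (X \<omega> $ j - mean M X $ j) \<partial>M)"


section \<open>Gaussian distributions and convergence in distribution\<close>

definition std_gaussian :: "(real ^ 'k) measure" where
  "std_gaussian =
     distr (\<Pi>\<^sub>M i\<in>UNIV. density lborel (\<lambda>x. ennreal (std_normal_density x))) borel (\<lambda>z. \<chi> i. z i)"

text \<open>\<open>\<N>(0, A)\<close> is the law of \<open>B Z\<close>, where \<open>Z\<close> is a standard Gaussian vector and \<open>B\<close> is a
  square matrix with \<open>B B\<^sup>T = A\<close>, so that its covariance matrix is \<open>A\<close>. Such a \<open>B\<close> exists if and only if \<open>A\<close> is symmetric and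
  positive semidefinite, and the law does not depend on which one is chosen. The matrix \<open>A\<close>
  may be singular.\<close>

definition centred_gaussian :: "real ^ 'k ^ 'k \<Rightarrow> (real ^ 'k) measure" where
  "centred_gaussian A =
     distr std_gaussian borel (\<lambda>z. (SOME B :: real ^ 'k ^ 'k. B ** transpose B = A) *v z)"

definition converges_in_distribution ::
  "(nat \<Rightarrow> 'a measure) \<Rightarrow> (nat \<Rightarrow> 'a \<Rightarrow> 'b::topological_space) \<Rightarrow> 'b measure \<Rightarrow> bool" where
  "converges_in_distribution M X N \<longleftrightarrow>
     (\<forall>f :: 'b \<Rightarrow> real. continuous_on UNIV f \<and> bounded (range f) \<longrightarrow>
        (\<lambda>n. \<integral>\<omega>. f (X n \<omega>) \<partial>(M n)) \<longlonglongrightarrow> (\<integral>x. f x \<partial>N))"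

end

theory Submission
  imports Defs "HOL-Complex_Analysis.Great_Picard"
begin

text \<open>
The proof has an analytic half, which produces a one-dimensional Gaussian limit in every positive
direction, and a soft half, which turns this into convergence of the whole vector.

\<^bold>\<open>Positive directions.\<close> Let \<open>a\<close> have positive coordinates. The moment generating function of
\<open>a \<bullet> Y\<close> is \<open>F t = P (exp (a\<^sub>1 t), \<dots>, exp (a\<^sub>k t))\<close>, and if \<open>0 < Im t\<close> and \<open>Im t * a\<^sub>i < pi\<close> for all
\<open>i\<close>, all arguments of \<open>P\<close> lie in the upper half plane; so real stability makes \<open>F\<close> zero-free in a
horizontal strip whose width depends on \<open>a\<close> alone. As the coefficients of \<open>F\<close> are positive,
\<open>\<bar>F\<bar>\<close> is at most \<open>F (Re t)\<close>. Comparing \<open>F\<close> with its reflection in a line parallel to the real axis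
(\<open>mgf_reflected_le\<close>) upgrades this: \<open>\<bar>F\<bar>\<close> decreases as \<open>t\<close> moves vertically away from
the real axis. Equivalently, the logarithmic derivative \<open>L = F' / F\<close> maps the upper part of the strip
into the closed upper half plane: it is typically real. For such a function the derivative at \<open>0\<close>
controls everything (\<open>typically_real_norm_le\<close>), and here that derivative is the variance \<open>v\<close> of \<open>a \<bullet> Y\<close>.
Integrating (\<open>mgf_gaussian_approximation\<close>) gives
\<open>ln (F t) = \<mu> t + v t\<^sup>2 / 2 + O(v \<bar>t\<bar>\<^sup>3)\<close> near \<open>0\<close>, where \<open>\<mu>\<close> is the mean and the implied constant
depends only on the width of the strip. Substituting \<open>\<tau> / s\<close> for \<open>t\<close>, the error becomes \<open>O(v / s\<^sup>2 * 1 / s)\<close>,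
which tends to \<open>0\<close> because \<open>v / s\<^sup>2\<close> converges and \<open>s\<close> tends to infinity.

\<^bold>\<open>All directions.\<close> Directions of mixed sign are out of reach of this argument, because there \<open>F\<close> may have
zeros close to the real axis. However, the moment generating functions of the scaled vectors are
entire functions on \<open>\<complex>\<^sup>k\<close>, and by convexity their boundedness in positive directions implies
locally uniform bounds everywhere. By Vitali's theorem (Montel's theorem and the identity theorem) convergence on the positive
cone propagates to all real directions and from there to the imaginary ones, which are the
characteristic functions (\<open>char_tendsto_of_mgf_tendsto_positive\<close>).

\<^bold>\<open>Convergence in distribution.\<close> The limit of the characteristic functions is that of the
Gaussian law with covariance \<open>A\<close>; its definition is meaningful because \<open>A\<close>, a limit of covariance matrices, is
positive semidefinite and hence of the form \<open>B ** transpose B\<close> (\<open>psd_matrix_square_root\<close>). Bounded second moments give tightness, and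
on a cube every continuous function is close to a trigonometric polynomial, which yields the
multivariate continuity theorem \<open>converges_in_distribution_if_char\<close>.
\<close>

section \<open>Moment generating functions without zeros in a strip\<close>

text \<open>
  The moment generating function of the law with mass \<open>p j\<close> at \<open>x j\<close>. The masses are indexed by \<open>S\<close>, so
  coinciding points \<open>x j\<close> need not be merged when a random vector is projected to a line, and
  dropping the condition \<open>sum p S = 1\<close> lets \<open>mgf S (\<lambda>j. p j * x j) x\<close> denote the derivative.
\<close>

definition mgf :: "'j set \<Rightarrow> ('j \<Rightarrow> real) \<Rightarrow> ('j \<Rightarrow> real) \<Rightarrow> complex \<Rightarrow> complex" where
  "mgf S p x t = (\<Sum>j\<in>S. of_real (p j) * exp (of_real (x j) * t))"

lemma mgf_cnj: "mgf S p x (cnj t) = cnj (mgf S p x t)"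
  by (simp add: mgf_def exp_cnj)

lemma mgf_minus: "mgf S p (\<lambda>j. - x j) t = mgf S p x (- t)"
  by (simp add: mgf_def)

lemma mgf_of_real: "mgf S p x (of_real r) = of_real (\<Sum>j\<in>S. p j * exp (x j * r))"
  by (simp add: mgf_def flip: exp_of_real)

lemma has_field_derivative_mgf:
  "(mgf S p x has_field_derivative mgf S (\<lambda>j. p j * x j) x t) (at t within T)"
  unfolding mgf_def by (auto intro!: derivative_eq_intros sum.cong)

lemma holomorphic_mgf [holomorphic_intros]:
  assumes "f holomorphic_on A"
  shows "(\<lambda>t. mgf S p x (f t)) holomorphic_on A"
  unfolding mgf_def by (intro holomorphic_intros assms)

lemma norm_mgf_le:
  assumes "\<And>j. j \<in> S \<Longrightarrow> p j \<ge> 0"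
  shows "norm (mgf S p x t) \<le> (\<Sum>j\<in>S. p j * exp (x j * Re t))"
proof -
  have "norm (mgf S p x t) \<le> (\<Sum>j\<in>S. norm (of_real (p j) * exp (of_real (x j) * t)))"
    unfolding mgf_def by (rule norm_sum)
  also have "\<dots> = (\<Sum>j\<in>S. p j * exp (x j * Re t))"
    using assms by (intro sum.cong) (auto simp: norm_mult)
  finally show ?thesis .
qed

lemma norm_mgf_le_norm_mgf_Re:
  assumes "\<And>j. j \<in> S \<Longrightarrow> p j \<ge> 0"
  shows "norm (mgf S p x t) \<le> norm (mgf S p x (of_real (Re t)))"
  using norm_mgf_le[of S p x t, OF assms] assms unfolding mgf_of_real norm_of_real by (simp add: sum_nonneg)

text \<open>
  Far to the right the terms with the largest exponent \<open>N\<close> dominate, and their sum is a constant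
  multiple of \<open>exp (N * t)\<close>, whose modulus depends only on \<open>Re t\<close>. This replaces a boundary condition at
  infinity when the maximum principle is applied in a strip.
\<close>

lemma mgf_ratio_at_top:
  assumes S: "finite S" "S \<noteq> {}" and p: "\<And>j. j \<in> S \<Longrightarrow> p j > 0" and "\<eta> > 0"
  shows "\<forall>\<^sub>F r in at_top. \<forall>s t. Re s = r \<longrightarrow> Re t = r \<longrightarrow>
           norm (mgf S p x s) \<le> (1 + \<eta>) * norm (mgf S p x t)"
proof -
  define N where "N = Max (x ` S)"
  define C where "C = (\<Sum>j | j \<in> S \<and> x j = N. p j)"
  define D where "D = (\<lambda>r. \<Sum>j | j \<in> S \<and> x j < N. p j * exp ((x j - N) * r))"
  have N: "x j \<le> N" if "j \<in> S" for j
    unfolding N_def using S that by auto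
  have "N \<in> x ` S"
    unfolding N_def using S by (intro Max_in) auto
  then have "C > 0"
    unfolding C_def using S p by (intro sum_pos) auto
  \<comment> \<open>the value for which \<open>(C + d) / (C - d) = 1 + \<eta>\<close>\<close>
  define d where "d = \<eta> * C / (2 + \<eta>)"
  have "d > 0" and d: "C + d \<le> (1 + \<eta>) * (C - d)"
    using \<open>\<eta> > 0\<close> \<open>C > 0\<close> by (auto simp: d_def field_simps)
  have split: "S = {j \<in> S. x j = N} \<union> {j \<in> S. x j < N}"
    using N by force
  have key: "norm (mgf S p x t * exp (- of_real N * t) - of_real C * exp 0) \<le> D (Re t)" for t
  proof -
    have "mgf S p x t * exp (- of_real N * t) = (\<Sum>j\<in>S. of_real (p j) * exp (of_real (x j - N) * t))"
      by (simp add: mgf_def sum_distrib_right mult.assoc flip: exp_add) (simp add: algebra_simps)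
    also have "\<dots> = (\<Sum>j | j \<in> S \<and> x j = N. of_real (p j) * exp (of_real (x j - N) * t)) + 
                   (\<Sum>j | j \<in> S \<and> x j < N. of_real (p j) * exp (of_real (x j - N) * t))"
      by (subst split, rule sum.union_disjoint) (use S in auto)
    also have "(\<Sum>j | j \<in> S \<and> x j = N. of_real (p j) * exp (of_real (x j - N) * t)) = complex_of_real C"
      by (auto simp: C_def intro!: sum.cong)
    finally have "mgf S p x t * exp (- of_real N * t) - of_real C * exp 0 =
       mgf {j \<in> S. x j < N} p (\<lambda>j. x j - N) t"
      by (simp add: mgf_def)
    then show ?thesis
      using norm_mgf_le[of "{j \<in> S. x j < N}" p "\<lambda>j. x j - N" t] p by (force simp: D_def less_imp_le)
  qed
  have "(D \<longlongrightarrow> (\<Sum>j | j \<in> S \<and> x j < N. p j * 0)) at_top"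
    unfolding D_def
  proof (intro tendsto_intros)
    fix j assume "j \<in> {j \<in> S. x j < N}"
    then have "x j - N < 0" by simp
    then show "((\<lambda>r. exp ((x j - N) * r)) \<longlongrightarrow> 0) at_top"
      by real_asymp
  qed
  then have "\<forall>\<^sub>F r in at_top. D r < d"
    using \<open>d > 0\<close> by (auto intro: order_tendstoD)
  then show ?thesis
  proof eventually_elim
    case (elim r)
    show ?case
    proof (intro allI impI)
      fix s t assume st: "Re s = r" "Re t = r"
      let ?e = "exp (- N * r)"
      have 1: "norm (mgf S p x s) * ?e \<le> C + d"
        using key[of s] norm_triangle_ineq2[of "mgf S p x s * exp (- of_real N * s)" "of_real C"] elim \<open>C > 0\<close>
        by (simp add: norm_mult st)
      have 2: "C - d \<le> norm (mgf S p x t) * ?e"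
        using key[of t] norm_triangle_ineq2[of "of_real C" "mgf S p x t * exp (- of_real N * t)" ] elim \<open>C > 0\<close>
        by (simp add: norm_mult st norm_minus_commute)
      have "norm (mgf S p x s) * ?e \<le> (1 + \<eta>) * (norm (mgf S p x t) * ?e)"
      proof -
        have "(1 + \<eta>) * (C - d) \<le> (1 + \<eta>) * (norm (mgf S p x t) * ?e)"
          by (rule mult_left_mono[OF 2]) (use \<open>\<eta> > 0\<close> in auto)
        with 1 d show ?thesis by linarith
      qed
      then show "norm (mgf S p x s) \<le> (1 + \<eta>) * norm (mgf S p x t)"
        by (simp flip: mult.assoc)
    qed
  qed
qed

lemma mgf_ratio_at_bot:
  assumes S: "finite S" "S \<noteq> {}" and p: "\<And>j. j \<in> S \<Longrightarrow> p j > 0" and "\<eta> > 0"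
  shows "\<forall>\<^sub>F r in at_top. \<forall>s t. Re s = - r \<longrightarrow> Re t = - r \<longrightarrow>
           norm (mgf S p x s) \<le> (1 + \<eta>) * norm (mgf S p x t)"
proof -
  have "\<forall>\<^sub>F r in at_top. \<forall>s t. Re s = r \<longrightarrow> Re t = r \<longrightarrow>
           norm (mgf S p x (- s)) \<le> (1 + \<eta>) * norm (mgf S p x (- t))"
    using mgf_ratio_at_top[OF S, of p \<eta> "\<lambda>j. - x j"] assms by (simp add: mgf_minus)
  then show ?thesis
  proof eventually_elim
    case (elim r)
    show ?case
    proof (intro allI impI)
      fix s t assume st: "Re s = - r" "Re t = - r"
      show "norm (mgf S p x s) \<le> (1 + \<eta>) * norm (mgf S p x t)"
        using elim[rule_format, of "-s" "-t"] st by simp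
    qed
  qed
qed

text \<open>
  The point \<open>cnj (t - 2 * \<i> * of_real \<theta>)\<close> is the mirror image of \<open>t\<close> in the line \<open>Im = \<theta>\<close>. The
  quotient of the two values of the moment generating function is holomorphic between the real axis
  and that line. On the line both points are conjugate, so the quotient has modulus \<open>1\<close>; on the
  real axis its modulus is at most \<open>1\<close> because the masses are positive. Near the two ends of the strip
  it is at most \<open>1 + \<eta>\<close>, and the maximum principle applies.
\<close>

lemma mgf_reflected_le:
  assumes S: "finite S" "S \<noteq> {}" and p: "\<And>j. j \<in> S \<Longrightarrow> p j > 0"
    and nz: "\<And>t. 0 \<le> Im t \<Longrightarrow> Im t < d \<Longrightarrow> mgf S p x t \<noteq> 0"
    and \<theta>: "0 \<le> \<theta>" "\<theta> < d" and t: "0 \<le> Im t" "Im t \<le> \<theta>"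
  shows "norm (mgf S p x (t - 2 * \<i> * of_real \<theta>)) \<le> norm (mgf S p x t)"
proof -
  define G where "G = (\<lambda>t. mgf S p x (t - 2 * \<i> * of_real \<theta>) / mgf S p x t)"
  have "norm (G t) \<le> 1 + \<eta>" if "\<eta> > 0" for \<eta>
  proof -
    have "\<forall>\<^sub>F r in at_top. \<bar>Re t\<bar> < r \<and> (\<forall>s t. Re s = r \<longrightarrow> Re t = r \<longrightarrow>
           norm (mgf S p x s) \<le> (1 + \<eta>) * norm (mgf S p x t)) \<and> (\<forall>s t. Re s = - r \<longrightarrow> Re t = - r \<longrightarrow>
           norm (mgf S p x s) \<le> (1 + \<eta>) * norm (mgf S p x t))"
      by (intro eventually_conj eventually_gt_at_top mgf_ratio_at_top mgf_ratio_at_bot) (use assms that in auto)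
    then obtain r where r: "\<bar>Re t\<bar> < r" 
      and ratio: "\<And>s t. Re s = r \<Longrightarrow> Re t = r \<Longrightarrow> norm (mgf S p x s) \<le> (1 + \<eta>) * norm (mgf S p x t)" 
        "\<And>s t. Re s = - r \<Longrightarrow> Re t = - r \<Longrightarrow> norm (mgf S p x s) \<le> (1 + \<eta>) * norm (mgf S p x t)"
      using eventually_happens' trivial_limit_at_top_linorder by fast
    define Q where "Q = cbox (Complex (-r) 0) (Complex r \<theta>)"
    have Q: "z \<in> Q \<longleftrightarrow> - r \<le> Re z \<and> Re z \<le> r \<and> 0 \<le> Im z \<and> Im z \<le> \<theta>" for z
      by (auto simp: Q_def in_cbox_complex_iff)
    have hol: "G holomorphic_on Q"
      unfolding G_def by (intro holomorphic_intros nz) (use \<theta> in \<open>auto simp: Q\<close>)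
    show ?thesis
    proof (rule maximum_modulus_frontier[where f = G and S = Q])
      show "G holomorphic_on interior Q"
        using hol interior_subset by (rule holomorphic_on_subset)
      show "continuous_on (closure Q) G"
        using holomorphic_on_imp_continuous_on[OF hol] by (simp add: Q_def)
      show "bounded Q" "t \<in> Q"
        using r t by (auto simp: Q_def in_cbox_complex_iff)
      fix z assume z: "z \<in> frontier Q"
      then have zQ: "z \<in> Q" and edge: "Re z = r \<or> Re z = - r \<or> Im z = 0 \<or> Im z = \<theta>"
        by (auto simp: Q_def frontier_cbox in_cbox_complex_iff in_box_complex_iff)
      have nzz: "mgf S p x z \<noteq> 0"
        using zQ \<theta> by (intro nz) (auto simp: Q)
      have "norm (mgf S p x (z - 2 * \<i> * of_real \<theta>)) \<le> (1 + \<eta>) * norm (mgf S p x z)"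
        using edge
      proof (elim disjE)
        assume "Im z = 0"
        then have "of_real (Re z) = z"
          by (simp add: complex_eq_iff)
        then have "norm (mgf S p x (z - 2 * \<i> * of_real \<theta>)) \<le> 1 * norm (mgf S p x z)"
          using norm_mgf_le_norm_mgf_Re[of S p x "z - 2 * \<i> * of_real \<theta>"] p
          by (simp add: less_imp_le)
        also have "\<dots> \<le> (1 + \<eta>) * norm (mgf S p x z)"
          using that by (intro mult_right_mono) auto
        finally show ?thesis .
      next
        assume "Im z = \<theta>"
        then have "z - 2 * \<i> * of_real \<theta> = cnj z"
          by (simp add: complex_eq_iff)
        then have "norm (mgf S p x (z - 2 * \<i> * of_real \<theta>)) = 1 * norm (mgf S p x z)"
          by (simp add: mgf_cnj)
        also have "\<dots> \<le> (1 + \<eta>) * norm (mgf S p x z)"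
          using that by (intro mult_right_mono) auto
        finally show ?thesis .
      next
        assume "Re z = r"
        then show ?thesis by (intro ratio(1)) auto
      next
        assume "Re z = - r"
        then show ?thesis by (intro ratio(2)) auto
      qed
      then show "norm (G z) \<le> 1 + \<eta>"
        using nzz by (simp add: G_def norm_divide field_simps)
    qed
  qed
  then have "norm (G t) \<le> 1"
    by (rule field_le_epsilon)
  moreover have "mgf S p x t \<noteq> 0"
    using t \<theta> by (intro nz) auto
  ultimately show ?thesis
    by (simp add: G_def norm_divide field_simps)
qed

text \<open>
  Two points on a vertical line are mirror images in the horizontal line halfway between them.
\<close>

lemma norm_mgf_antimono:
  assumes S: "finite S" "S \<noteq> {}" and p: "\<And>j. j \<in> S \<Longrightarrow> p j > 0"
    and nz: "\<And>t. 0 \<le> Im t \<Longrightarrow> Im t < d \<Longrightarrow> mgf S p x t \<noteq> 0"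
    and y: "0 \<le> y" "y \<le> y'" "y' < d"
  shows "norm (mgf S p x (Complex u y')) \<le> norm (mgf S p x (Complex u y))"
proof -
  have "norm (mgf S p x (Complex u y - 2 * \<i> * of_real ((y + y') / 2))) \<le> norm (mgf S p x (Complex u y))"
    by (rule mgf_reflected_le[OF S p nz]) (use y in auto)
  also have "Complex u y - 2 * \<i> * of_real ((y + y') / 2) = cnj (Complex u y')"
    by (simp add: complex_eq_iff)
  finally show ?thesis
    by (simp add: mgf_cnj)
qed

text \<open>
  Up to a positive factor, the imaginary part of the logarithmic derivative is minus the vertical
  derivative of the squared modulus, which decreases.
\<close>

lemma Im_log_deriv_mgf_nonneg:
  assumes S: "finite S" "S \<noteq> {}" and p: "\<And>j. j \<in> S \<Longrightarrow> p j > 0"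
    and nz: "\<And>t. 0 \<le> Im t \<Longrightarrow> Im t < d \<Longrightarrow> mgf S p x t \<noteq> 0"
    and t: "0 < Im t" "Im t < d"
  shows "Im (mgf S (\<lambda>j. p j * x j) x t / mgf S p x t) \<ge> 0"
proof -
  define f where "f = (\<lambda>y. mgf S p x (Complex (Re t) y))"
  define f' where "f' = mgf S (\<lambda>j. p j * x j) x t"
  have f_t: "f (Im t) = mgf S p x t"
    by (simp add: f_def)
  have "(f has_vector_derivative \<i> * f') (at (Im t))"
  proof -
    have "((\<lambda>y. of_real (Re t) + \<i> * complex_of_real y) has_vector_derivative \<i>) (at (Im t))"
      by (auto intro!: derivative_eq_intros)
    moreover have "(mgf S p x has_field_derivative f') (at (of_real (Re t) + \<i> * complex_of_real (Im t)))"
      using has_field_derivative_mgf[of S p x t UNIV] by (simp add: f'_def flip: complex_eq)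
    ultimately have "((mgf S p x \<circ> (\<lambda>y. of_real (Re t) + \<i> * complex_of_real y)) has_vector_derivative \<i> * f') (at (Im t))"
      by (rule field_vector_diff_chain_at)
    then show ?thesis
      by (simp add: f_def comp_def Complex_eq)
  qed
  then have der: "((\<lambda>y. f y \<bullet> f y) has_real_derivative (f (Im t) \<bullet> (\<i> * f') + (\<i> * f') \<bullet> f (Im t))) (at (Im t))"
    unfolding has_field_derivative_def has_vector_derivative_def
    by (auto intro!: derivative_eq_intros simp: fun_eq_iff algebra_simps)
  have "f (Im t) \<bullet> (\<i> * f') + (\<i> * f') \<bullet> f (Im t) \<le> 0"
  proof (rule ccontr)
    assume "\<not> ?thesis"
    then obtain e where e: "e > 0" "\<And>h. 0 < h \<Longrightarrow> h < e \<Longrightarrow> f (Im t) \<bullet> f (Im t) < f (Im t + h) \<bullet> f (Im t + h)"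
      using DERIV_pos_inc_right[OF der] by auto
    define h where "h = min (e / 2) ((d - Im t) / 2)"
    have h: "0 < h" "h < e" "Im t + h < d"
      using e t by (auto simp: h_def min_def field_simps)
    have "norm (f (Im t + h)) \<le> norm (f (Im t))"
      unfolding f_def by (rule norm_mgf_antimono[OF S p nz]) (use h t in auto)
    then have "f (Im t + h) \<bullet> f (Im t + h) \<le> f (Im t) \<bullet> f (Im t)"
      by (simp add: dot_square_norm power_mono)
    with e(2)[of h] h show False by simp
  qed
  then have "Im f' * Re (f (Im t)) - Re f' * Im (f (Im t)) \<ge> 0"
    by (simp add: inner_complex_def algebra_simps)
  then show ?thesis
    by (simp add: Im_divide f'_def[symmetric] f_t divide_nonneg_pos)
qed

section \<open>Typically real functions and the Gaussian approximation\<close>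

text \<open>
  The Cayley transform \<open>(P - b) / (P + b)\<close> maps into the unit disc and vanishes at \<open>0\<close>, so the Schwarz
  lemma bounds it. Since \<open>b\<close> may be \<open>0\<close>, the argument is applied to \<open>P + \<eta> / 2\<close>.
\<close>

lemma Re_nonneg_norm_diff_le:
  assumes P: "P holomorphic_on ball 0 \<rho>" and Re: "\<And>z. norm z < \<rho> \<Longrightarrow> Re (P z) \<ge> 0"
    and P0: "P 0 = of_real b" and z: "norm z \<le> \<rho> / 2" and \<rho>: "\<rho> > 0"
  shows "norm (P z - of_real b) \<le> 4 * b * norm z / \<rho>"
proof -
  have "b \<ge> 0"
    using Re[of 0] P0 \<rho> by simp
  have "norm (P z - of_real b) \<le> 4 * b * norm z / \<rho> + \<eta>" if "\<eta> > 0" for \<eta>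
  proof -
    define c where "c = b + \<eta> / 2"
    define Q where "Q = (\<lambda>z. P (of_real \<rho> * z) + of_real (\<eta> / 2))"
    define w where "w = (\<lambda>z. (Q z - of_real c) / (Q z + of_real c))"
    have "c > 0"
      using \<open>b \<ge> 0\<close> that by (simp add: c_def)
    have ReQ: "Re (Q z) > 0" if "norm z < 1" for z
      using Re[of "of_real \<rho> * z"] that \<rho> \<open>\<eta> > 0\<close> by (simp add: Q_def norm_mult)
    have nz: "Q z + of_real c \<noteq> 0" if "norm z < 1" for z
      using ReQ[OF that] \<open>c > 0\<close> by (auto simp: complex_eq_iff)
    have "(P \<circ> (\<lambda>z. of_real \<rho> * z)) holomorphic_on ball 0 1"
      by (rule holomorphic_on_compose_gen[OF _ P]) (use \<rho> in \<open>auto intro!: holomorphic_intros simp: norm_mult\<close>)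
    then have "Q holomorphic_on ball 0 1"
      unfolding Q_def comp_def by (intro holomorphic_intros)
    then have holw: "w holomorphic_on ball 0 1"
      unfolding w_def by (intro holomorphic_intros) (use nz in auto)
    have "w 0 = 0"
      by (simp add: w_def Q_def c_def P0)
    moreover have "norm (w z) < 1" if "norm z < 1" for z
    proof -
      have "(norm (Q z - of_real c))\<^sup>2 < (norm (Q z + of_real c))\<^sup>2"
        using mult_pos_pos[OF ReQ[OF that] \<open>c > 0\<close>] unfolding cmod_power2 
        by (simp add: power2_eq_square algebra_simps)
      then have "norm (Q z - of_real c) < norm (Q z + of_real c)"
        by (rule power2_less_imp_less) simp
      then show ?thesis
        using nz[OF that] by (simp add: w_def norm_divide)
    qed
    moreover define \<zeta> where "\<zeta> = z / of_real \<rho>"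
    have \<zeta>: "norm \<zeta> \<le> 1 / 2" and \<zeta>': "norm \<zeta> = norm z / \<rho>"
      using z \<rho> by (auto simp: \<zeta>_def norm_divide field_simps)
    moreover have "norm \<zeta> < 1"
      using \<zeta> by linarith
    ultimately have w: "norm (w \<zeta>) \<le> norm \<zeta>"
      by (intro Schwarz_Lemma(1)[OF holw])
    define X where "X = norm (P z - of_real b)"
    have QP: "Q \<zeta> - of_real c = P z - of_real b"
      using \<rho> by (simp add: Q_def \<zeta>_def c_def)
    have "P z - of_real b = w \<zeta> * (Q \<zeta> + of_real c)"
      using nz[of \<zeta>] \<zeta> by (simp add: w_def flip: QP)
    also have "Q \<zeta> + of_real c = (P z - of_real b) + of_real (2 * c)"
      using QP by (simp add: algebra_simps)
    finally have "X = norm (w \<zeta>) * norm ((P z - of_real b) + of_real (2 * c))"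
      unfolding X_def by (metis norm_mult)
    also have "\<dots> \<le> norm \<zeta> * (X + 2 * c)"
      using w norm_triangle_ineq[of "P z - of_real b" "of_real (2 * c)"] \<open>c > 0\<close>
      by (intro mult_mono) (auto simp: X_def)
    also have "\<dots> \<le> X / 2 + norm \<zeta> * (2 * c)"
      using mult_right_mono[OF \<zeta>, of X] by (simp add: X_def algebra_simps)
    finally have "X \<le> 4 * c * norm \<zeta>"
      by (simp add: algebra_simps)
    also have "\<dots> \<le> 4 * b * norm \<zeta> + \<eta>"
      using mult_left_mono[OF \<zeta>, of \<eta>] that by (simp add: c_def algebra_simps)
    finally show ?thesis
      by (simp add: X_def \<zeta>')
  qed
  then show ?thesis
    by (rule field_le_epsilon)
qed

text \<open>
  If \<open>f\<close> is typically real, that is, \<open>Im (f z)\<close> has the sign of \<open>Im z\<close>, then Rogosinski's transform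
  \<open>p z = (1 - z\<^sup>2 / \<rho>\<^sup>2) * (f z - f 0) / z\<close> has nonnegative real part on the circle of radius \<open>\<rho>\<close>,
  because there \<open>(1 - z\<^sup>2 / \<rho>\<^sup>2) / z = (cnj z - z) / \<rho>\<^sup>2\<close> is imaginary. By the maximum principle this
  persists inside. As \<open>p 0\<close> is the derivative \<open>b\<close> of \<open>f\<close> at \<open>0\<close>, the whole function is controlled by \<open>b\<close>.
  That the error is proportional to \<open>b\<close> is the point of the lemma.
\<close>

lemma typically_real_norm_le:
  assumes f: "f holomorphic_on ball 0 r" and Im: "\<And>z. norm z < r \<Longrightarrow> Im z * Im (f z) \<ge> 0"
    and f0: "Im (f 0) = 0" and b: "(f has_field_derivative of_real b) (at 0)"
    and \<rho>: "0 < \<rho>" "\<rho> < r" and z: "norm z \<le> \<rho> / 2"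
  shows "norm (f z - f 0 - of_real b * z) \<le> 6 * b * (norm z)\<^sup>2 / \<rho>"
proof -
  define q where "q = (\<lambda>z. if z = 0 then deriv f 0 else (f z - f 0) / (z - 0))"
  define p where "p = (\<lambda>z. (1 - (z / of_real \<rho>)\<^sup>2) * q z)"
  have q0: "q 0 = of_real b"
    using DERIV_imp_deriv[OF b] by (simp add: q_def)
  have "q holomorphic_on ball 0 r"
    unfolding q_def by (rule pole_lemma_open[OF f]) simp
  then have p: "p holomorphic_on ball 0 r"
    unfolding p_def by (intro holomorphic_intros) (use \<rho> in auto)
  have sub: "cball 0 \<rho> \<subseteq> ball (0::complex) r" "ball 0 \<rho> \<subseteq> ball (0::complex) r"
    using \<rho> by auto
  have Re_p: "Re (p z) \<ge> 0" if "norm z < \<rho>" for z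
  proof -
    have "Re (- p z) \<le> 0"
    proof (rule maximum_real_frontier[where f = "\<lambda>z. - p z" and \<xi> = z and S = "cball 0 \<rho>"])
      show "(\<lambda>z. - p z) holomorphic_on interior (cball 0 \<rho>)"
        using holomorphic_on_subset[OF p sub(2)] by (auto intro!: holomorphic_intros)
      show "continuous_on (closure (cball 0 \<rho>)) (\<lambda>z. - p z)"
        using holomorphic_on_imp_continuous_on[OF holomorphic_on_subset[OF p sub(1)]]
        by (auto intro!: continuous_intros)
      fix z :: complex assume "z \<in> frontier (cball 0 \<rho>)"
      then have nz: "norm z = \<rho>"
        by (simp add: frontier_cball)
      then have "z \<noteq> 0"
        using \<rho> by auto
      have zz: "z * cnj z = of_real \<rho> * of_real \<rho>"
        using nz by (simp add: complex_norm_square[symmetric] power2_eq_square)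
      have "(1 - (z / of_real \<rho>)\<^sup>2) / z = (cnj z - z) / (of_real \<rho>)\<^sup>2"
        using \<open>z \<noteq> 0\<close> \<rho> zz by (simp add: field_simps power2_eq_square)
      moreover have "p z = (1 - (z / of_real \<rho>)\<^sup>2) / z * (f z - f 0)"
        using \<open>z \<noteq> 0\<close> by (simp add: p_def q_def)
      ultimately have "p z = (cnj z - z) * (f z - f 0) / (of_real \<rho>)\<^sup>2"
        by simp
      then have "Re (p z) = Re ((cnj z - z) * (f z - f 0)) / \<rho>\<^sup>2"
        by (simp flip: of_real_power)
      also have "Re ((cnj z - z) * (f z - f 0)) = 2 * (Im z * Im (f z))"
        by (simp add: f0)
      finally show "Re (- p z) \<le> 0"
        using Im[of z] \<rho> nz by simp
    qed (use that in auto)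
    then show ?thesis by simp
  qed
  define \<zeta> where "\<zeta> = z / of_real \<rho>"
  have \<zeta>: "norm \<zeta> \<le> 1 / 2" and \<zeta>': "norm z / \<rho> = norm \<zeta>"
    using z \<rho> by (auto simp: \<zeta>_def norm_divide field_simps)
  have "b \<ge> 0"
    using Re_p[of 0] \<rho> by (simp add: p_def q0)
  have p_b: "norm (p z - of_real b) \<le> 4 * b * norm \<zeta>"
  proof -
    have "norm (p z - of_real b) \<le> 4 * b * norm z / \<rho>"
      by (rule Re_nonneg_norm_diff_le[OF holomorphic_on_subset[OF p sub(2)] Re_p])
         (use z \<rho> in \<open>auto simp: p_def q0\<close>)
    then show ?thesis
      unfolding \<zeta>'[symmetric] by simp
  qed
  have "(norm \<zeta>)\<^sup>2 \<le> norm \<zeta> / 2"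
    using mult_right_mono[OF \<zeta>, of "norm \<zeta>"] by (simp add: power2_eq_square)
  then have sq: "norm (of_real b * \<zeta>\<^sup>2) \<le> b * norm \<zeta> / 2" "(norm \<zeta>)\<^sup>2 \<le> 1 / 4"
    using \<open>b \<ge> 0\<close> \<zeta> mult_left_mono[of "(norm \<zeta>)\<^sup>2" "norm \<zeta> / 2" b] by (auto simp: norm_mult norm_power)
  have "3 / 4 \<le> norm (1 - \<zeta>\<^sup>2)"
    using norm_triangle_ineq2[of 1 "\<zeta>\<^sup>2"] sq by (simp add: norm_power)
  then have "3 / 4 * norm (q z - of_real b) \<le> norm (1 - \<zeta>\<^sup>2) * norm (q z - of_real b)"
    by (rule mult_right_mono) simp
  also have "\<dots> = norm ((p z - of_real b) + of_real b * \<zeta>\<^sup>2)"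
    unfolding norm_mult[symmetric] by (simp add: p_def \<zeta>_def algebra_simps)
  also have "\<dots> \<le> 4 * b * norm \<zeta> + b * norm \<zeta> / 2"
    using norm_triangle_ineq[of "p z - of_real b" "of_real b * \<zeta>\<^sup>2"] p_b sq by linarith
  finally have qb: "norm (q z - of_real b) \<le> 6 * b * norm \<zeta>"
    by simp
  have "f z - f 0 - of_real b * z = z * (q z - of_real b)"
    by (cases "z = 0") (simp_all add: q_def field_simps)
  then have "norm (f z - f 0 - of_real b * z) = norm z * norm (q z - of_real b)"
    by (simp add: norm_mult)
  also have "\<dots> \<le> norm z * (6 * b * norm \<zeta>)"
    by (rule mult_left_mono[OF qb]) simp
  finally show ?thesis
    by (simp add: \<zeta>'[symmetric] power2_eq_square mult_ac)
qed

text \<open>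
  The logarithmic derivative \<open>L\<close> is typically real and satisfies \<open>L 0 = \<mu>\<close> and \<open>deriv L 0 = v\<close>. Integrating
  the bound for \<open>L z - \<mu> - v * z\<close> along the segment from \<open>0\<close> to \<open>t\<close> gives the bound for the error of
  the second-order expansion of the logarithm.
\<close>

lemma mgf_gaussian_approximation:
  fixes S :: "'j set" and p x :: "'j \<Rightarrow> real"
  assumes S: "finite S" "S \<noteq> {}" and p: "\<And>j. j \<in> S \<Longrightarrow> p j > 0" and sum_p: "sum p S = 1"
    and nz: "\<And>t. 0 < Im t \<Longrightarrow> Im t < d \<Longrightarrow> mgf S p x t \<noteq> 0"
    and \<rho>: "0 < \<rho>" "\<rho> < d" and t: "norm t \<le> \<rho> / 2"
  defines "\<mu> \<equiv> \<Sum>j\<in>S. p j * x j"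
  defines "v \<equiv> (\<Sum>j\<in>S. p j * (x j)\<^sup>2) - \<mu>\<^sup>2"
  obtains e where "mgf S p x t = exp (of_real \<mu> * t + of_real v * t\<^sup>2 / 2 + e)"
    and "norm e \<le> 6 * v * norm t ^ 3 / \<rho>"
proof -
  let ?m1 = "mgf S (\<lambda>j. p j * x j) x" and ?m2 = "mgf S (\<lambda>j. p j * x j * x j) x"
  have at0: "mgf S p x 0 = 1" "?m1 0 = of_real \<mu>" "?m2 0 = of_real (v + \<mu>\<^sup>2)"
    using arg_cong[OF sum_p, of complex_of_real]
    by (auto simp: mgf_def \<mu>_def v_def power2_eq_square mult_ac)
  have nz': "mgf S p x t \<noteq> 0" if "\<bar>Im t\<bar> < d" for t
  proof -
    consider "Im t > 0" | "Im t < 0" | "Im t = 0" by linarith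
    then show ?thesis
    proof cases
      case 2
      then show ?thesis using nz[of "cnj t"] that by (simp add: mgf_cnj)
    next
      case 3
      then obtain r where r: "t = of_real r"
        by (metis complex_is_Real_iff Reals_cases)
      have "(\<Sum>j\<in>S. p j * exp (x j * r)) > 0"
        using S p by (intro sum_pos) auto
      then show ?thesis
        unfolding r mgf_of_real of_real_eq_0_iff by simp
    qed (use nz that in auto)
  qed
  define L where "L = (\<lambda>t. ?m1 t / mgf S p x t)"
  have nzb: "mgf S p x z \<noteq> 0" if "norm z < d" for z
    using nz'[of z] abs_Im_le_cmod[of z] that by simp
  have L: "L holomorphic_on ball 0 d"
    unfolding L_def by (intro holomorphic_intros) (auto simp: nzb)
  have L0: "L 0 = of_real \<mu>"
    by (simp add: L_def at0)
  have ImL: "Im z * Im (L z) \<ge> 0" if "norm z < d" for z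
  proof -
    have *: "Im (L z) \<ge> 0" if "Im z > 0" "norm z < d" for z
      unfolding L_def
      by (rule Im_log_deriv_mgf_nonneg[OF S p nz', where d = d]) (use that abs_Im_le_cmod[of z] in auto)
    consider "Im z > 0" | "Im z < 0" | "Im z = 0" by linarith
    then show ?thesis
    proof cases
      case 1
      with *[of z] that show ?thesis by simp
    next
      case 2
      have "L (cnj z) = cnj (L z)"
        by (simp add: L_def mgf_cnj)
      then show ?thesis
        using *[of "cnj z"] that 2 by (simp add: zero_le_mult_iff)
    qed simp
  qed
  have derL: "(L has_field_derivative of_real v) (at 0)"
    unfolding L_def
    by (auto intro!: derivative_eq_intros has_field_derivative_mgf simp: at0)
       (simp add: power2_eq_square)
  have L_approx: "norm (L z - of_real \<mu> - of_real v * z) \<le> 6 * v * (norm z)\<^sup>2 / \<rho>" 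
    if "norm z \<le> \<rho> / 2" for z
    using typically_real_norm_le[OF L ImL _ derL \<rho> that] by (simp add: L0)
  obtain g0 where g0: "g0 holomorphic_on ball 0 d" "\<And>z. z \<in> ball 0 d \<Longrightarrow> exp (g0 z) = mgf S p x z"
    by (rule holomorphic_logarithm_exists[of "ball 0 d" "mgf S p x" 0])
       (use \<rho> in \<open>auto intro!: holomorphic_intros simp: nzb\<close>)
  define g where "g = (\<lambda>z. g0 z - g0 0)"
  define E where "E = (\<lambda>z. g z - of_real \<mu> * z - of_real v * z\<^sup>2 / 2)"
  have g: "exp (g z) = mgf S p x z" if "norm z < d" for z
    using g0(2)[of z] g0(2)[of 0] \<rho> that by (simp add: g_def exp_diff at0)
  have dg: "(g has_field_derivative L z) (at z)" if "norm z < d" for z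
  proof -
    have g': "(g has_field_derivative deriv g0 z) (at z)"
      unfolding g_def
      by (rule derivative_eq_intros holomorphic_derivI[OF g0(1)] refl)+ (use that in auto)
    have "((\<lambda>w. exp (g w)) has_field_derivative exp (g z) * deriv g0 z) (at z)"
      by (rule derivative_eq_intros g' refl)+
    moreover have "((\<lambda>w. exp (g w)) has_field_derivative ?m1 z) (at z)"
    proof (rule has_field_derivative_transform_within[OF has_field_derivative_mgf])
      show "0 < d - norm z"
        using that by simp
      show "mgf S p x w = exp (g w)" if "dist w z < d - norm z" for w :: complex
        using g[of w] norm_triangle_sub[of w z] that by (simp add: dist_norm)
    qed simp
    ultimately have "mgf S p x z * deriv g0 z = ?m1 z"
      using DERIV_unique g that by metis
    then have "deriv g0 z = L z"
      using nzb[OF that] by (simp add: L_def field_simps)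
    with g' show ?thesis by simp
  qed
  have "norm (E t - E 0) \<le> 6 * v * (norm t)\<^sup>2 / \<rho> * norm (t - 0)"
  proof (rule field_differentiable_bound[where S = "cball 0 (norm t)"])
    fix z :: complex assume z: "z \<in> cball 0 (norm t)"
    then have zd: "norm z \<le> \<rho> / 2"
      using t by auto
    show "(E has_field_derivative L z - of_real \<mu> - of_real v * z) (at z within cball 0 (norm t))"
    proof (rule has_field_derivative_at_within)
      have "(g has_field_derivative L z) (at z)"
        using zd \<rho> by (intro dg) linarith
      then show "(E has_field_derivative L z - of_real \<mu> - of_real v * z) (at z)"
        unfolding E_def by (auto intro!: derivative_eq_intros)
    qed
    have "b \<ge> 0 \<Longrightarrow> 6 * b * (norm z)\<^sup>2 / \<rho> \<le> 6 * b * (norm t)\<^sup>2 / \<rho>" for b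
      using z \<rho> by (intro divide_right_mono mult_left_mono power_mono) auto
    moreover have "v \<ge> 0"
    proof -
      have "0 \<le> 6 * v * (norm (of_real (\<rho> / 2) :: complex))\<^sup>2 / \<rho>"
        by (rule order_trans[OF norm_ge_zero L_approx]) (use \<rho> in auto)
      then show ?thesis
        using \<rho> by (simp add: zero_le_mult_iff zero_le_divide_iff)
    qed
    ultimately show "norm (L z - of_real \<mu> - of_real v * z) \<le> 6 * v * (norm t)\<^sup>2 / \<rho>"
      using L_approx[OF zd] by (meson order_trans)
  qed auto
  then have "norm (E t) \<le> 6 * v * norm t ^ 3 / \<rho>"
    by (simp add: E_def g_def power3_eq_cube power2_eq_square mult_ac)
  moreover have "mgf S p x t = exp (of_real \<mu> * t + of_real v * t\<^sup>2 / 2 + E t)"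
    using g[of t] t \<rho> by (simp add: E_def)
  ultimately show ?thesis
    using that by blast
qed

section \<open>Positive semidefinite matrices and Gaussian laws\<close>

lemma inner_symmetric_matrix:
  fixes A :: "real ^ 'k ^ 'k"
  assumes "transpose A = A"
  shows "x \<bullet> (A *v y) = (A *v x) \<bullet> y"
  by (metis assms dot_lmul_matrix transpose_matrix_vector)

lemma quadratic_form_line:
  fixes A :: "real ^ 'k ^ 'k"
  assumes "transpose A = A"
  shows "(x + t *\<^sub>R y) \<bullet> (A *v (x + t *\<^sub>R y)) = x \<bullet> (A *v x) + 2 * t * (x \<bullet> (A *v y)) + t\<^sup>2 * (y \<bullet> (A *v y))"
  using inner_symmetric_matrix[OF assms, of x y]
  by (simp add: matrix_vector_right_distrib matrix_vector_mult_scaleR inner_add_left inner_add_right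
      power2_eq_square inner_commute algebra_simps)

lemma inner_matrix_axis:
  fixes A :: "real ^ 'k ^ 'k"
  shows "x \<bullet> (A *v axis m 1) = (\<Sum>i\<in>UNIV. x $ i * A $ i $ m)"
  by (simp add: matrix_vector_mult_basis column_def inner_vec_def)

text \<open>
  Symmetric Gaussian elimination. If the pivot \<open>a = A $ m $ m\<close> is positive, subtracting the outer
  product of the \<open>m\<close>-th column with itself, divided by \<open>a\<close>, clears the \<open>m\<close>-th row and keeps the form
  nonnegative, since its new value at \<open>x\<close> is the minimum of the old one on the line through \<open>x\<close> parallel
  to the \<open>m\<close>-th axis. If \<open>a = 0\<close>, nonnegativity forces the whole
  \<open>m\<close>-th row to vanish.
\<close>

lemma psd_eq_sum_outer_products:
  fixes A :: "real ^ 'k ^ 'k"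
  assumes "finite S" "transpose A = A" "\<And>x. x \<bullet> (A *v x) \<ge> 0" "\<And>i j. i \<notin> S \<Longrightarrow> A $ i $ j = 0"
  shows "\<exists>c :: 'k \<Rightarrow> real ^ 'k. \<forall>i j. A $ i $ j = (\<Sum>m\<in>S. c m $ i * c m $ j)"
  using assms
proof (induction S arbitrary: A)
  case empty
  then show ?case by simp
next
  case (insert m S)
  have sym: "A $ i $ j = A $ j $ i" for i j
    using arg_cong[OF insert.prems(1), of "\<lambda>B. B $ j $ i"] by (simp add: transpose_def)
  define a where "a = A $ m $ m"
  define b where "b = (\<lambda>x. x \<bullet> (A *v axis m 1))"
  have q_m: "axis m 1 \<bullet> (A *v axis m 1) = a"
    by (simp add: matrix_vector_mult_basis column_def inner_axis' a_def)
  have line: "x \<bullet> (A *v x) + 2 * t * b x + t\<^sup>2 * a \<ge> 0" for x t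
    using insert.prems(2)[of "x + t *\<^sub>R axis m 1"]
    unfolding quadratic_form_line[OF insert.prems(1)] q_m b_def .
  define A' where "A' = (\<chi> i j. A $ i $ j - A $ i $ m * A $ j $ m / a)"
  have A'_q: "x \<bullet> (A' *v x) = x \<bullet> (A *v x) - (b x)\<^sup>2 / a" for x
  proof -
    have bx: "b x = (\<Sum>i\<in>UNIV. x $ i * A $ i $ m)"
      by (simp add: b_def inner_matrix_axis)
    have "x \<bullet> (A' *v x) = (\<Sum>i\<in>UNIV. \<Sum>j\<in>UNIV. x $ i * (A $ i $ j * x $ j) - x $ i * A $ i $ m * (x $ j * A $ j $ m) / a)"
      by (simp add: inner_vec_def matrix_vector_mult_def A'_def sum_distrib_left algebra_simps)
    also have "\<dots> = x \<bullet> (A *v x) - b x * b x / a"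
      unfolding bx sum_product sum_divide_distrib sum_subtractf
      by (simp add: inner_vec_def matrix_vector_mult_def sum_distrib_left)
    finally show ?thesis by (simp add: power2_eq_square)
  qed
  have "a \<ge> 0"
    using insert.prems(2)[of "axis m 1"] by (simp add: q_m)
  show ?case
  proof (cases "a = 0")
    case True
    have "A $ m $ j = 0" for j
    proof -
      define x where "x = (axis j 1 :: real ^ 'k)"
      have "b x = A $ j $ m"
        by (simp add: b_def x_def inner_axis' matrix_vector_mult_basis column_def)
      moreover have "b x = 0"
      proof (rule ccontr)
        assume "b x \<noteq> 0"
        then show False
          \<comment> \<open>on the line in direction \<open>axis m 1\<close> the form is affine; this \<open>t\<close> gives it the value \<open>-1\<close>\<close>
          using line[of x "- (x \<bullet> (A *v x) + 1) / (2 * b x)"] True by (simp add: field_simps)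
      qed
      ultimately show ?thesis using sym by simp
    qed
    then have "\<exists>c :: 'k \<Rightarrow> real ^ 'k. \<forall>i j. A $ i $ j = (\<Sum>m\<in>S. c m $ i * c m $ j)"
    proof (intro insert.IH insert.prems(1,2))
      show "A $ i $ j = 0" if "i \<notin> S" for i j
        using that insert.prems(3)[of i j] \<open>\<And>j. A $ m $ j = 0\<close> by (cases "i = m") auto
    qed
    then obtain c :: "'k \<Rightarrow> real ^ 'k" where c: "\<And>i j. A $ i $ j = (\<Sum>m\<in>S. c m $ i * c m $ j)"
      by blast
    have "(\<Sum>l\<in>S. (c(m := 0)) l $ i * (c(m := 0)) l $ j) = (\<Sum>l\<in>S. c l $ i * c l $ j)" for i j
      using insert.hyps by (intro sum.cong) auto
    then have "\<forall>i j. A $ i $ j = (\<Sum>l\<in>insert m S. (c(m := 0)) l $ i * (c(m := 0)) l $ j)"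
      using insert.hyps c by simp
    then show ?thesis by blast
  next
    case False
    with \<open>a \<ge> 0\<close> have "a > 0" by simp
    have "\<exists>c :: 'k \<Rightarrow> real ^ 'k. \<forall>i j. A' $ i $ j = (\<Sum>m\<in>S. c m $ i * c m $ j)"
    proof (rule insert.IH)
      show "transpose A' = A'"
        by (simp add: transpose_def A'_def vec_eq_iff sym mult.commute)
      show "x \<bullet> (A' *v x) \<ge> 0" for x
        \<comment> \<open>the minimum of the form on the line in direction \<open>axis m 1\<close>\<close>
        using line[of x "- b x / a"] \<open>a > 0\<close> by (simp add: A'_q power2_eq_square field_simps)
      show "A' $ i $ j = 0" if "i \<notin> S" for i j
      proof (cases "i = m")
        case True
        then show ?thesis using \<open>a > 0\<close> sym[of m j] by (simp add: A'_def a_def)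
      next
        case False
        with that insert.prems(3) show ?thesis by (simp add: A'_def)
      qed
    qed
    then obtain c :: "'k \<Rightarrow> real ^ 'k" where c: "\<And>i j. A' $ i $ j = (\<Sum>m\<in>S. c m $ i * c m $ j)"
      by blast
    define c' where "c' = c(m := (\<chi> i. A $ i $ m / sqrt a))"
    have "(\<Sum>l\<in>S. c' l $ i * c' l $ j) = A' $ i $ j" for i j
      unfolding c c'_def using insert.hyps by (intro sum.cong) auto
    moreover have "c' m $ i * c' m $ j = A $ i $ m * A $ j $ m / a" for i j
      using \<open>a > 0\<close> by (simp add: c'_def)
    ultimately have "\<forall>i j. A $ i $ j = (\<Sum>l\<in>insert m S. c' l $ i * c' l $ j)"
      using insert.hyps by (simp add: A'_def)
    then show ?thesis by blast
  qed
qed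

lemma psd_matrix_square_root:
  fixes A :: "real ^ 'k ^ 'k"
  assumes "transpose A = A" "\<And>x. x \<bullet> (A *v x) \<ge> 0"
  shows "\<exists>B :: real ^ 'k ^ 'k. B ** transpose B = A"
proof -
  obtain c :: "'k \<Rightarrow> real ^ 'k" where c: "\<And>i j. A $ i $ j = (\<Sum>m\<in>UNIV. c m $ i * c m $ j)"
    using psd_eq_sum_outer_products[OF finite assms, of UNIV] by auto
  then have "(\<chi> i m. c m $ i) ** transpose (\<chi> i m. c m $ i) = A"
    by (simp add: matrix_matrix_mult_def transpose_def vec_eq_iff)
  then show ?thesis by blast
qed

lemma borel_measurable_vec_lambda:
  "(\<lambda>z. \<chi> i. z i) \<in> borel_measurable (\<Pi>\<^sub>M i\<in>(UNIV :: 'k::finite set). std_normal_distribution)"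
proof (subst borel_measurable_euclidean_space, intro ballI)
  fix b :: "real ^ 'k" assume "b \<in> Basis"
  then obtain i where b: "b = axis i 1"
    by (auto simp: Basis_vec_def)
  have "(\<lambda>z. z i) \<in> borel_measurable (\<Pi>\<^sub>M i\<in>(UNIV :: 'k set). std_normal_distribution)"
    by (rule measurable_compose[OF measurable_component_singleton[of i]]) auto
  then show "(\<lambda>z. (\<chi> i. z i) \<bullet> b) \<in> borel_measurable (\<Pi>\<^sub>M i\<in>(UNIV :: 'k set). std_normal_distribution)"
    by (simp add: b inner_axis)
qed

lemma std_gaussian_altdef:
  "std_gaussian = distr (\<Pi>\<^sub>M i\<in>(UNIV :: 'k::finite set). std_normal_distribution) borel (\<lambda>z. \<chi> i. z i)"
  by (simp add: std_gaussian_def)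

lemma prob_space_std_gaussian: "prob_space (std_gaussian :: (real ^ 'k) measure)"
proof -
  interpret prob_space "\<Pi>\<^sub>M i\<in>(UNIV :: 'k set). std_normal_distribution"
    by (intro prob_space_PiM prob_space_normal_density) simp
  show ?thesis
    unfolding std_gaussian_altdef by (rule prob_space_distr[OF borel_measurable_vec_lambda])
qed

lemma borel_measurable_matrix_vector_mult:
  fixes B :: "real ^ 'k ^ 'm"
  shows "(\<lambda>z. B *v z) \<in> borel_measurable borel"
  by (intro borel_measurable_continuous_onI linear_continuous_on matrix_vector_mul_bounded_linear)

lemma char_std_gaussian:
  "(\<integral>x. iexp (\<eta> \<bullet> x) \<partial>(std_gaussian :: (real ^ 'k) measure)) = of_real (exp (- (\<eta> \<bullet> \<eta>) / 2))"
proof -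
  interpret std: prob_space std_normal_distribution
    by (rule prob_space_normal_density) simp
  interpret product_sigma_finite "\<lambda>i::'k. std_normal_distribution"
    by unfold_locales
  have "(\<integral>x. iexp (\<eta> \<bullet> x) \<partial>(std_gaussian :: (real ^ 'k) measure)) =
        (\<integral>z. iexp (\<eta> \<bullet> (\<chi> i. z i)) \<partial>(\<Pi>\<^sub>M i\<in>(UNIV :: 'k set). std_normal_distribution))"
    unfolding std_gaussian_altdef
    by (rule integral_distr[OF borel_measurable_vec_lambda])
       (intro borel_measurable_continuous_onI continuous_intros)
  also have "\<dots> = (\<integral>z. (\<Prod>i\<in>UNIV. iexp (\<eta> $ i * z i)) \<partial>(\<Pi>\<^sub>M i\<in>(UNIV :: 'k set). std_normal_distribution))"
    by (simp add: inner_vec_def sum_distrib_left flip: exp_sum)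
  also have "\<dots> = (\<Prod>i\<in>UNIV. char std_normal_distribution (\<eta> $ i))"
    unfolding char_def by (rule product_integral_prod) (auto intro!: std.integrable_iexp)
  also have "\<dots> = of_real (exp (- (\<eta> \<bullet> \<eta>) / 2))"
    by (simp add: char_std_normal_distribution inner_vec_def power2_eq_square sum_negf sum_divide_distrib 
        flip: exp_sum of_real_prod)
  finally show ?thesis .
qed

lemma
  fixes A :: "real ^ 'k ^ 'k"
  assumes "\<exists>B :: real ^ 'k ^ 'k. B ** transpose B = A"
  shows prob_space_centred_gaussian: "prob_space (centred_gaussian A)"
    and sets_centred_gaussian: "sets (centred_gaussian A) = sets borel"
    and char_centred_gaussian: 
      "(\<integral>x. iexp (\<theta> \<bullet> x) \<partial>centred_gaussian A) = of_real (exp (- (\<theta> \<bullet> (A *v \<theta>)) / 2))"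
proof -
  define B where "B = (SOME B :: real ^ 'k ^ 'k. B ** transpose B = A)"
  have B: "B ** transpose B = A"
    unfolding B_def using assms by (rule someI_ex)
  have N: "centred_gaussian A = distr std_gaussian borel (\<lambda>z. B *v z)"
    by (simp add: centred_gaussian_def B_def)
  have meas: "(\<lambda>z. B *v z) \<in> borel_measurable std_gaussian"
    using borel_measurable_matrix_vector_mult[of B] by (simp add: std_gaussian_def)
  show "sets (centred_gaussian A) = sets borel"
    by (simp add: N)
  show "prob_space (centred_gaussian A)"
    unfolding N by (rule prob_space.prob_space_distr[OF prob_space_std_gaussian meas])
  have adj: "\<theta> \<bullet> (B *v z) = (transpose B *v \<theta>) \<bullet> z" for z
    by (metis dot_lmul_matrix transpose_matrix_vector)
  have "(\<integral>x. iexp (\<theta> \<bullet> x) \<partial>centred_gaussian A) = (\<integral>z. iexp (\<theta> \<bullet> (B *v z)) \<partial>std_gaussian)"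
    unfolding N
    by (rule integral_distr[OF meas]) (intro borel_measurable_continuous_onI continuous_intros)
  also have "\<dots> = of_real (exp (- ((transpose B *v \<theta>) \<bullet> (transpose B *v \<theta>)) / 2))"
    unfolding adj by (rule char_std_gaussian)
  also have "(transpose B *v \<theta>) \<bullet> (transpose B *v \<theta>) = \<theta> \<bullet> (A *v \<theta>)"
    unfolding adj[symmetric] by (simp only: matrix_vector_mul_assoc B)
  finally show "(\<integral>x. iexp (\<theta> \<bullet> x) \<partial>centred_gaussian A) = of_real (exp (- (\<theta> \<bullet> (A *v \<theta>)) / 2))" .
qed

section \<open>The continuity theorem for characteristic functions\<close>

text \<open>
  Finite linear combinations of characters. Convergence of characteristic functions says exactly that
  expectations of such functions converge.
\<close>

inductive trig_poly :: "('a::real_inner \<Rightarrow> complex) \<Rightarrow> bool" where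
  char: "trig_poly (\<lambda>x. c * iexp (\<theta> \<bullet> x))"
| add: "trig_poly f \<Longrightarrow> trig_poly g \<Longrightarrow> trig_poly (\<lambda>x. f x + g x)"

lemma trig_poly_const: "trig_poly (\<lambda>x. c)"
  using trig_poly.char[of c 0] by simp

lemma trig_poly_sum:
  assumes "\<And>i. i \<in> I \<Longrightarrow> trig_poly (f i)"
  shows "trig_poly (\<lambda>x. \<Sum>i\<in>I. f i x)"
  using assms by (induction I rule: infinite_finite_induct) (auto intro: trig_poly_const trig_poly.add)

lemma trig_poly_mult:
  assumes "trig_poly f" "trig_poly g"
  shows "trig_poly (\<lambda>x. f x * g x)"
  using assms(1)
proof induction
  case (char c \<theta>)
  show ?case
    using assms(2)
  proof induction
    case (char c' \<theta>')
    have "(\<lambda>x. c * iexp (\<theta> \<bullet> x) * (c' * iexp (\<theta>' \<bullet> x))) = (\<lambda>x. (c * c') * iexp ((\<theta> + \<theta>') \<bullet> x))"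
      by (simp add: fun_eq_iff inner_add_left ring_distribs exp_add mult_ac)
    then show ?case
      using trig_poly.char by metis
  next
    case (add f g)
    then show ?case by (simp add: ring_distribs trig_poly.add)
  qed
next
  case (add f g)
  then show ?case by (simp add: ring_distribs trig_poly.add)
qed

lemma trig_poly_sin: "trig_poly (\<lambda>x. of_real (sin (\<theta> \<bullet> x)))"
proof -
  have "(\<lambda>x. complex_of_real (sin (\<theta> \<bullet> x))) =
        (\<lambda>x. (- \<i> / 2) * iexp (\<theta> \<bullet> x) + (\<i> / 2) * iexp ((- \<theta>) \<bullet> x))"
    by (simp add: fun_eq_iff complex_eq_iff exp_eq_polar cis.sel Re_exp Im_exp)
  then show ?thesis
    by (simp only: trig_poly.intros)
qed

lemma trig_poly_real_polynomial_sin: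
  fixes g :: "real ^ 'k \<Rightarrow> real"
  assumes "real_polynomial_function g"
  shows "trig_poly (\<lambda>x. of_real (g (\<chi> i. sin (x $ i / L))))"
  using assms
proof induction
  case (linear f)
  have expand: "f y = (\<Sum>i\<in>UNIV. f (axis i 1) * y $ i)" for y
  proof -
    interpret f: bounded_linear f by fact
    have "f y = f (\<Sum>i\<in>UNIV. y $ i *\<^sub>R axis i 1)"
      using basis_expansion[of y] by (simp add: scalar_mult_eq_scaleR)
    then show ?thesis
      by (simp add: f.sum f.scaleR mult.commute)
  qed
  have "(\<lambda>x. complex_of_real (f (\<chi> i. sin (x $ i / L)))) =
    (\<lambda>x. \<Sum>i\<in>UNIV. of_real (f (axis i 1)) * of_real (sin (((1 / L) *\<^sub>R axis i 1) \<bullet> x)))"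
  proof
    fix x :: "real ^ 'k"
    show "complex_of_real (f (\<chi> i. sin (x $ i / L))) =
      (\<Sum>i\<in>UNIV. of_real (f (axis i 1)) * of_real (sin (((1 / L) *\<^sub>R axis i 1) \<bullet> x)))"
      unfolding expand[of "\<chi> i. sin (x $ i / L)"] by (simp add: inner_axis')
  qed
  then show ?case
    by (simp only:) (intro trig_poly_sum trig_poly_mult trig_poly_const trig_poly_sin)
qed (simp_all add: trig_poly_const trig_poly.add trig_poly_mult)

lemma trig_poly_bounded_measurable:
  fixes f :: "'a::euclidean_space \<Rightarrow> complex"
  assumes "trig_poly f"
  shows "f \<in> borel_measurable borel \<and> (\<exists>B. \<forall>x. norm (f x) \<le> B)"
  using assms
proof induction
  case (char c \<theta>)
  have "(\<lambda>x. c * iexp (\<theta> \<bullet> x)) \<in> borel_measurable borel"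
    by (intro borel_measurable_continuous_onI continuous_intros)
  then show ?case by (auto simp: norm_mult)
next
  case (add f g)
  then obtain B C where "\<And>x. norm (f x) \<le> B" "\<And>x. norm (g x) \<le> C" by blast
  then have "norm (f x + g x) \<le> B + C" for x
    by (meson add_mono norm_triangle_le)
  with add show ?case by (auto intro!: exI[of _ "B + C"])
qed

lemma integrable_trig_poly:
  fixes f :: "'a::euclidean_space \<Rightarrow> complex"
  assumes "prob_space M" "X \<in> borel_measurable M" "trig_poly f"
  shows "integrable M (\<lambda>\<omega>. f (X \<omega>))"
proof -
  interpret prob_space M by fact
  obtain B where "\<And>x. norm (f x) \<le> B" and "f \<in> borel_measurable borel"
    using trig_poly_bounded_measurable[OF assms(3)] by blast
  then show ?thesis
    using assms(2) by (intro integrable_const_bound[where B = B]) auto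
qed

lemma tendsto_integral_trig_poly:
  fixes f :: "'b::euclidean_space \<Rightarrow> complex"
  assumes "\<And>n. prob_space (M n)" "\<And>n. X n \<in> borel_measurable (M n)"
    and "prob_space N" "sets N = sets borel"
    and char: "\<And>\<theta>. (\<lambda>n. \<integral>\<omega>. iexp (\<theta> \<bullet> X n \<omega>) \<partial>M n) \<longlonglongrightarrow> (\<integral>x. iexp (\<theta> \<bullet> x) \<partial>N)"
    and f: "trig_poly f"
  shows "(\<lambda>n. \<integral>\<omega>. f (X n \<omega>) \<partial>M n) \<longlonglongrightarrow> (\<integral>x. f x \<partial>N)"
  using f
proof induction
  case (char c \<theta>)
  show ?case
    using tendsto_mult_left[OF assms(5)] by simp
next
  case (add f g)
  have "(\<lambda>x. x) \<in> borel_measurable N"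
    using assms(4) by (simp add: measurable_cong_sets[OF assms(4) refl])
  then have "integrable N f" "integrable N g"
    using integrable_trig_poly[OF assms(3)] add by blast+
  moreover have "integrable (M n) (\<lambda>\<omega>. f (X n \<omega>))" "integrable (M n) (\<lambda>\<omega>. g (X n \<omega>))" for n
    using integrable_trig_poly[OF assms(1,2)] add by blast+
  ultimately show ?case
    using tendsto_add[OF add.IH] by simp
qed

text \<open>
  The function \<open>f\<close> is approximated on the cube of half-width \<open>R\<close> only, but the trigonometric polynomial has to stay
  bounded on the whole space. Both are achieved by writing \<open>f x = F (sin (x / L))\<close> for \<open>x\<close> in the cube, coordinatewise, with \<open>L\<close>
  so large that \<open>arcsin\<close> inverts the sine there, and approximating \<open>F\<close> on \<open>[-1, 1]\<^sup>k\<close> by an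
  ordinary polynomial: the sine never leaves \<open>[-1, 1]\<close>.
\<close>

lemma trig_poly_approximation:
  fixes f :: "real ^ 'k \<Rightarrow> real"
  assumes f: "continuous_on UNIV f" and B: "\<And>x. \<bar>f x\<bar> \<le> B" and "R > 0" "\<epsilon> > 0"
  shows "\<exists>T. trig_poly (\<lambda>x. of_real (T x)) \<and> (\<forall>x. \<bar>T x\<bar> \<le> B + \<epsilon>) \<and>
           (\<forall>x. (\<forall>i. \<bar>x $ i\<bar> \<le> R) \<longrightarrow> \<bar>f x - T x\<bar> \<le> \<epsilon>)"
proof -
  define L where "L = 2 * R / pi"
  define Q where "Q = cbox (\<chi> i. -1) (\<chi> i. 1 :: real ^ 'k)"
  define F where "F = (\<lambda>y. f (\<chi> i. L * arcsin (y $ i)))"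
  have abs_le_1: "\<bar>a\<bar> \<le> 1 \<longleftrightarrow> - 1 \<le> a \<and> a \<le> 1" for a :: real
    by auto
  have Q: "y \<in> Q \<longleftrightarrow> (\<forall>i. \<bar>y $ i\<bar> \<le> 1)" for y
    by (simp add: Q_def mem_box_cart abs_le_1)
  have "L > 0" using \<open>R > 0\<close> by (simp add: L_def)
  have "continuous_on Q (\<lambda>y. \<chi> i. L * arcsin (y $ i))"
    by (intro continuous_intros continuous_on_vec_lambda) (simp_all add: Q abs_le_1)
  then have "continuous_on Q F"
    unfolding F_def by (intro continuous_on_compose2[OF f]) auto
  then obtain g where g: "real_polynomial_function g" "\<And>y. y \<in> Q \<Longrightarrow> \<bar>F y - g y\<bar> < \<epsilon>"
    using Stone_Weierstrass_real_polynomial_function[of Q F \<epsilon>] \<open>\<epsilon> > 0\<close> by (auto simp: Q_def)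
  define T where "T = (\<lambda>x. g (\<chi> i. sin (x $ i / L)))"
  have sinQ: "(\<chi> i. sin (x $ i / L)) \<in> Q" for x :: "real ^ 'k"
    by (simp add: Q)
  show ?thesis
  proof (intro exI conjI allI impI)
    show "trig_poly (\<lambda>x. of_real (T x))"
      unfolding T_def by (rule trig_poly_real_polynomial_sin[OF g(1)])
    show "\<bar>T x\<bar> \<le> B + \<epsilon>" for x
      using g(2)[OF sinQ[of x]] B[of "\<chi> i. L * arcsin ((\<chi> i. sin (x $ i / L)) $ i)"]
      by (simp add: T_def F_def)
    show "\<bar>f x - T x\<bar> \<le> \<epsilon>" if x: "\<forall>i. \<bar>x $ i\<bar> \<le> R" for x
    proof -
      have "L * arcsin (sin (x $ i / L)) = x $ i" for i
      proof -
        have "\<bar>x $ i / L\<bar> \<le> pi / 2"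
          using mult_right_mono[OF x[rule_format, of i], of "pi / (2 * R)"] \<open>R > 0\<close>
          by (simp add: L_def abs_mult abs_divide mult.commute)
        then have "arcsin (sin (x $ i / L)) = x $ i / L"
          by (intro arcsin_sin) linarith+
        then show ?thesis
          using \<open>L > 0\<close> by simp
      qed
      then show ?thesis
        using g(2)[OF sinQ[of x]] by (simp add: T_def F_def)
    qed
  qed
qed

text \<open>
  On the cube of half-width \<open>R\<close> the two integrands differ by at most \<open>\<epsilon>\<close>; outside, an event of
  probability at most \<open>\<eta>\<close>, by at most \<open>2 * B + \<epsilon>\<close>.
\<close>

lemma integral_diff_le_off_cube:
  fixes f T :: "real ^ 'k \<Rightarrow> real"
  assumes "prob_space M" and X: "X \<in> borel_measurable M"
    and f: "f \<in> borel_measurable borel" "\<And>x. \<bar>f x\<bar> \<le> B"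
    and T: "T \<in> borel_measurable borel" "\<And>x. \<bar>T x\<bar> \<le> B + \<epsilon>"
    and fT: "\<And>x. (\<forall>i. \<bar>x $ i\<bar> \<le> R) \<Longrightarrow> \<bar>f x - T x\<bar> \<le> \<epsilon>"
    and bad: "measure M {\<omega> \<in> space M. \<exists>i. R < \<bar>X \<omega> $ i\<bar>} \<le> \<eta>" and "\<epsilon> \<ge> 0"
  shows "\<bar>(\<integral>\<omega>. f (X \<omega>) \<partial>M) - (\<integral>\<omega>. T (X \<omega>) \<partial>M)\<bar> \<le> \<epsilon> + (2 * B + \<epsilon>) * \<eta>"
proof -
  interpret prob_space M by fact
  define A where "A = {\<omega> \<in> space M. \<exists>i. R < \<bar>X \<omega> $ i\<bar>}"
  have "{\<omega> \<in> space M. R < \<bar>X \<omega> $ i\<bar>} \<in> sets M" for i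
    by (intro borel_measurable_less borel_measurable_abs measurable_compose[OF X borel_measurable_nth]) simp
  moreover have "A = (\<Union>i. {\<omega> \<in> space M. R < \<bar>X \<omega> $ i\<bar>})"
    by (auto simp: A_def)
  ultimately have A[measurable]: "A \<in> sets M"
    by simp
  have "B \<ge> 0"
    using f(2)[of 0] by linarith
  have "integrable M (\<lambda>\<omega>. f (X \<omega>))"
    using f X by (intro integrable_const_bound[where B = B]) auto
  moreover have "integrable M (\<lambda>\<omega>. T (X \<omega>))"
    using T X by (intro integrable_const_bound[where B = "B + \<epsilon>"]) auto
  ultimately have int: "integrable M (\<lambda>\<omega>. f (X \<omega>))" "integrable M (\<lambda>\<omega>. T (X \<omega>))"
    by blast+
  have "\<bar>(\<integral>\<omega>. f (X \<omega>) \<partial>M) - (\<integral>\<omega>. T (X \<omega>) \<partial>M)\<bar> = \<bar>\<integral>\<omega>. f (X \<omega>) - T (X \<omega>) \<partial>M\<bar>"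
    using int by simp
  also have "\<dots> \<le> (\<integral>\<omega>. \<bar>f (X \<omega>) - T (X \<omega>)\<bar> \<partial>M)"
    by (rule integral_abs_bound)
  also have "\<dots> \<le> (\<integral>\<omega>. \<epsilon> + (2 * B + \<epsilon>) * indicator A \<omega> \<partial>M)"
  proof (rule integral_mono)
    show "integrable M (\<lambda>\<omega>. \<bar>f (X \<omega>) - T (X \<omega>)\<bar>)"
      using int by simp
    show "integrable M (\<lambda>\<omega>. \<epsilon> + (2 * B + \<epsilon>) * indicator A \<omega>)"
      by (simp add: integrable_real_indicator emeasure_eq_measure)
    fix \<omega> assume "\<omega> \<in> space M"
    show "\<bar>f (X \<omega>) - T (X \<omega>)\<bar> \<le> \<epsilon> + (2 * B + \<epsilon>) * indicator A \<omega>"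
    proof (cases "\<omega> \<in> A")
      case True
      then show ?thesis
        using f(2)[of "X \<omega>"] T(2)[of "X \<omega>"] \<open>\<epsilon> \<ge> 0\<close> by (simp add: abs_le_iff)
    next
      case False
      then show ?thesis
        using fT[of "X \<omega>"] \<open>\<omega> \<in> space M\<close> by (auto simp: A_def not_less)
    qed
  qed
  also have "\<dots> = \<epsilon> + (2 * B + \<epsilon>) * measure M A"
    by (simp add: integrable_real_indicator emeasure_eq_measure prob_space)
  also have "\<dots> \<le> \<epsilon> + (2 * B + \<epsilon>) * \<eta>"
    using bad \<open>B \<ge> 0\<close> \<open>\<epsilon> \<ge> 0\<close> by (intro add_left_mono mult_left_mono) (auto simp: A_def)
  finally show ?thesis .
qed

lemma tight_vec:
  fixes N :: "(real ^ 'k) measure"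
  assumes "prob_space N" "sets N = sets borel" "\<eta> > 0"
  shows "\<forall>\<^sub>F R in at_top. measure N {x \<in> space N. \<exists>i. R < \<bar>x $ i\<bar>} \<le> \<eta>"
proof -
  interpret prob_space N by fact
  define A where "A = (\<lambda>m::nat. {x \<in> space N. \<exists>i. real m < \<bar>x $ i\<bar>})"
  have [measurable_cong]: "sets N = sets borel" by fact
  have A: "{x \<in> space N. \<exists>i. R < \<bar>x $ i\<bar>} \<in> sets N" for R
    by measurable
  have "(\<lambda>m. measure N (A m)) \<longlonglongrightarrow> measure N (\<Inter>m. A m)"
    by (rule finite_Lim_measure_decseq) (use A in \<open>auto simp: A_def decseq_def intro: le_less_trans[OF of_nat_mono]\<close>)
  moreover have "(\<Inter>m. A m) = {}"
  proof -
    have "x \<notin> A m" if "m = nat \<lceil>norm x\<rceil>" for x m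
    proof -
      have "\<bar>x $ i\<bar> \<le> real m" for i
        using component_le_norm_cart[of x i] that by linarith
      then show ?thesis
        by (auto simp: A_def not_less)
    qed
    then show ?thesis by blast
  qed
  ultimately have "\<forall>\<^sub>F m in sequentially. measure N (A m) < \<eta>"
    using \<open>\<eta> > 0\<close> by (auto intro: order_tendstoD)
  then obtain m where m: "measure N (A m) < \<eta>"
    by (auto simp: eventually_sequentially)
  have "measure N {x \<in> space N. \<exists>i. R < \<bar>x $ i\<bar>} \<le> \<eta>" if "R \<ge> real m" for R
  proof -
    have "measure N {x \<in> space N. \<exists>i. R < \<bar>x $ i\<bar>} \<le> measure N (A m)"
      using A that by (intro finite_measure_mono) (auto simp: A_def intro: le_less_trans)
    with m show ?thesis by simp
  qed
  then show ?thesis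
    by (rule eventually_at_top_linorderI)
qed

text \<open>
  The multivariate continuity theorem for a tight sequence and a known limit law. By tightness a bounded continuous
  function may be replaced by the trigonometric polynomial of \<open>trig_poly_approximation\<close>, uniformly in
  \<open>n\<close>, and for trigonometric polynomials convergence is the hypothesis on characteristic functions.
\<close>

theorem converges_in_distribution_if_char:
  fixes X :: "nat \<Rightarrow> 'a \<Rightarrow> real ^ 'k"
  assumes M: "\<And>n. prob_space (M n)" and X: "\<And>n. X n \<in> borel_measurable (M n)"
    and N: "prob_space N" "sets N = sets borel"
    and char: "\<And>\<theta>. (\<lambda>n. \<integral>\<omega>. iexp (\<theta> \<bullet> X n \<omega>) \<partial>M n) \<longlonglongrightarrow> (\<integral>x. iexp (\<theta> \<bullet> x) \<partial>N)"
    and tight: "\<And>\<eta>. \<eta> > 0 \<Longrightarrow> \<forall>\<^sub>F R in at_top. \<forall>n. measure (M n) {\<omega> \<in> space (M n). \<exists>i. R < \<bar>X n \<omega> $ i\<bar>} \<le> \<eta>"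
  shows "converges_in_distribution M X N"
  unfolding converges_in_distribution_def
proof (intro allI impI, elim conjE)
  fix f :: "real ^ 'k \<Rightarrow> real"
  assume f: "continuous_on UNIV f" and "bounded (range f)"
  then obtain B where "B > 0" and B: "\<And>x. \<bar>f x\<bar> \<le> B"
    unfolding bounded_pos by auto
  have fm: "f \<in> borel_measurable borel"
    using f by (rule borel_measurable_continuous_onI)
  show "(\<lambda>n. \<integral>\<omega>. f (X n \<omega>) \<partial>M n) \<longlonglongrightarrow> (\<integral>x. f x \<partial>N)"
  proof (rule LIMSEQ_I)
    fix r :: real assume "r > 0"
    define \<epsilon> where "\<epsilon> = r / 6"
    define \<eta> where "\<eta> = \<epsilon> / (2 * B + \<epsilon>)"
    have "\<epsilon> > 0"
      using \<open>r > 0\<close> by (simp add: \<epsilon>_def)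
    with \<open>B > 0\<close> have "2 * B + \<epsilon> > 0"
      by linarith
    with \<open>\<epsilon> > 0\<close> have pos: "\<epsilon> > 0" "\<eta> > 0" and \<eta>: "(2 * B + \<epsilon>) * \<eta> = \<epsilon>"
      by (simp_all add: \<eta>_def)
    have "\<forall>\<^sub>F R in at_top. R > 0 \<and> (\<forall>n. measure (M n) {\<omega> \<in> space (M n). \<exists>i. R < \<bar>X n \<omega> $ i\<bar>} \<le> \<eta>) \<and>
        measure N {x \<in> space N. \<exists>i. R < \<bar>x $ i\<bar>} \<le> \<eta>"
      by (intro eventually_conj eventually_gt_at_top tight tight_vec N pos)
    from eventually_happens'[OF trivial_limit_at_top_linorder this]
    obtain R where R: "R > 0" "\<And>n. measure (M n) {\<omega> \<in> space (M n). \<exists>i. R < \<bar>X n \<omega> $ i\<bar>} \<le> \<eta>"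
        "measure N {x \<in> space N. \<exists>i. R < \<bar>x $ i\<bar>} \<le> \<eta>"
      by blast
    from trig_poly_approximation[OF f B R(1) pos(1)]
    obtain T where T: "trig_poly (\<lambda>x. of_real (T x))" and TB: "\<And>x. \<bar>T x\<bar> \<le> B + \<epsilon>"
      and fT: "\<And>x. (\<forall>i. \<bar>x $ i\<bar> \<le> R) \<Longrightarrow> \<bar>f x - T x\<bar> \<le> \<epsilon>"
      by blast
    have "(\<lambda>x. complex_of_real (T x)) \<in> borel_measurable borel"
      using trig_poly_bounded_measurable[OF T] by blast
    then have "(\<lambda>x. Re (complex_of_real (T x))) \<in> borel_measurable borel"
      by measurable
    then have Tm: "T \<in> borel_measurable borel"
      by simp
    have N_id: "(\<lambda>x. x) \<in> borel_measurable N"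
      by (simp add: measurable_cong_sets[OF N(2) refl])
    have "(\<lambda>n. complex_of_real (\<integral>\<omega>. T (X n \<omega>) \<partial>M n)) \<longlonglongrightarrow> complex_of_real (\<integral>x. T x \<partial>N)"
      using tendsto_integral_trig_poly[OF M X N char T] by simp
    then have "(\<lambda>n. \<integral>\<omega>. T (X n \<omega>) \<partial>M n) \<longlonglongrightarrow> (\<integral>x. T x \<partial>N)"
      unfolding tendsto_of_real_iff .
    from LIMSEQ_D[OF this pos(1)] obtain n0 where n0: "\<And>n. n \<ge> n0 \<Longrightarrow> \<bar>(\<integral>\<omega>. T (X n \<omega>) \<partial>M n) - (\<integral>x. T x \<partial>N)\<bar> < \<epsilon>"
      by auto
    have "\<bar>(\<integral>\<omega>. f (X n \<omega>) \<partial>M n) - (\<integral>x. f x \<partial>N)\<bar> < r" if "n \<ge> n0" for n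
    proof -
      have "\<bar>(\<integral>\<omega>. f (X n \<omega>) \<partial>M n) - (\<integral>\<omega>. T (X n \<omega>) \<partial>M n)\<bar> \<le> \<epsilon> + (2 * B + \<epsilon>) * \<eta>"
        by (rule integral_diff_le_off_cube[OF M X fm B Tm TB fT R(2)]) (use pos in auto)
      moreover have "\<bar>(\<integral>x. f x \<partial>N) - (\<integral>x. T x \<partial>N)\<bar> \<le> \<epsilon> + (2 * B + \<epsilon>) * \<eta>"
        by (rule integral_diff_le_off_cube[OF N(1) N_id fm B Tm TB fT R(3)]) (use pos in auto)
      ultimately show ?thesis
        using n0[OF that] pos(1) \<epsilon>_def unfolding \<eta> by linarith
    qed
    then show "\<exists>n0. \<forall>n\<ge>n0. norm ((\<integral>\<omega>. f (X n \<omega>) \<partial>M n) - (\<integral>x. f x \<partial>N)) < r"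
      by auto
  qed
qed

section \<open>From positive directions to characteristic functions\<close>

text \<open>
  A case of Vitali's theorem. If convergence failed at \<open>\<tau>\<close>, a subsequence would stay away from
  \<open>g \<tau>\<close>; by Montel's theorem it has a further subsequence with a holomorphic limit, which agrees with \<open>g\<close> on a
  punctured real neighbourhood of \<open>0\<close> and hence everywhere.
\<close>

lemma entire_functions_tendsto_from_real_axis:
  fixes h :: "nat \<Rightarrow> complex \<Rightarrow> complex"
  assumes h: "\<And>n. h n holomorphic_on UNIV" and g: "g holomorphic_on UNIV"
    and bdd: "\<And>R. \<exists>C. \<forall>n \<tau>. norm \<tau> \<le> R \<longrightarrow> norm (h n \<tau>) \<le> C"
    and lim: "\<forall>\<^sub>F t in at 0. (\<lambda>n. h n (complex_of_real t)) \<longlonglongrightarrow> g (of_real t)"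
  shows "(\<lambda>n. h n \<tau>) \<longlonglongrightarrow> g \<tau>"
proof (rule ccontr)
  assume "\<not> ?thesis"
  then obtain e where e: "e > 0" and "\<And>m. \<exists>n\<ge>m. norm (h n \<tau> - g \<tau>) \<ge> e"
    unfolding LIMSEQ_iff by (meson not_le)
  then have "\<exists>\<^sub>\<infinity>n. norm (h n \<tau> - g \<tau>) \<ge> e"
    unfolding INFM_nat_le by blast
  then obtain r :: "nat \<Rightarrow> nat" where r: "strict_mono r" "\<And>n. norm (h (r n) \<tau> - g \<tau>) \<ge> e"
    using infinite_enumerate[of "{n. norm (h n \<tau> - g \<tau>) \<ge> e}"] by (auto simp: frequently_cofinite)
  have loc: "\<exists>B. \<forall>k\<in>range h. \<forall>z\<in>K. norm (k z) \<le> B" if "compact K" for K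
  proof -
    from compact_imp_bounded[OF that] obtain R where "\<forall>z\<in>K. norm z \<le> R"
      unfolding bounded_iff by blast
    with bdd[of R] show ?thesis by blast
  qed
  have "\<exists>g' r'. g' holomorphic_on UNIV \<and> strict_mono (r' :: nat \<Rightarrow> nat) \<and> (\<forall>x. (\<lambda>n. h (r (r' n)) x) \<longlonglongrightarrow> g' x)"
  proof (rule Montel[of UNIV "range h" "\<lambda>n. h (r n)"])
    fix g' and r' :: "nat \<Rightarrow> nat"
    assume "g' holomorphic_on UNIV" "strict_mono r'" "\<And>x. x \<in> UNIV \<Longrightarrow> (\<lambda>n. h (r (r' n)) x) \<longlonglongrightarrow> g' x"
    then show ?thesis by auto
  qed (use h loc in auto)
  then obtain g' r' where g': "g' holomorphic_on UNIV" "strict_mono (r' :: nat \<Rightarrow> nat)"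
    and lim': "\<And>x. (\<lambda>n. h (r (r' n)) x) \<longlonglongrightarrow> g' x"
    by blast
  obtain d where d: "d > 0" "\<And>t. t \<noteq> 0 \<Longrightarrow> \<bar>t\<bar> < d \<Longrightarrow> (\<lambda>n. h n (complex_of_real t)) \<longlonglongrightarrow> g (of_real t)"
    using lim unfolding eventually_at by (auto simp: dist_norm)
  define U where "U = complex_of_real ` {t. t \<noteq> 0 \<and> \<bar>t\<bar> < d}"
  have "g' z = g z" if "z \<in> U" for z
  proof -
    from that obtain t where t: "z = of_real t" "t \<noteq> 0" "\<bar>t\<bar> < d"
      by (auto simp: U_def)
    have "(\<lambda>n. h (r (r' n)) z) \<longlonglongrightarrow> g z"
      using LIMSEQ_subseq_LIMSEQ[OF LIMSEQ_subseq_LIMSEQ[OF d(2)[OF t(2,3)] r(1)] g'(2)]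
      by (simp add: o_def t(1))
    with lim' show ?thesis
      by (rule LIMSEQ_unique)
  qed
  moreover have "0 islimpt U"
    unfolding islimpt_approachable
  proof (intro allI impI)
    fix e :: real assume "e > 0"
    show "\<exists>z\<in>U. z \<noteq> 0 \<and> dist z 0 < e"
      using \<open>e > 0\<close> \<open>d > 0\<close>
      by (intro bexI[of _ "complex_of_real (min (d / 2) (e / 2))"]) (auto simp: U_def min_def)
  qed
  ultimately have "g' \<tau> - g \<tau> = 0"
    using holomorphic_on_diff[OF g'(1) g]
    by (intro analytic_continuation[of "\<lambda>z. g' z - g z" UNIV U 0 \<tau>]) (simp_all add: convex_connected)
  then have "(\<lambda>n. norm (h (r (r' n)) \<tau> - g \<tau>)) \<longlonglongrightarrow> 0"
    using tendsto_norm[OF tendsto_diff[OF lim'[of \<tau>] tendsto_const[of "g \<tau>"]]] by simp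
  then have "e \<le> 0"
    by (rule LIMSEQ_le_const) (use r(2) in auto)
  with e show False by simp
qed

lemma exp_inner_le:
  fixes x z :: "real ^ 'k"
  assumes x: "\<And>i. \<bar>x $ i\<bar> \<le> K"
  shows "exp (x \<bullet> z) \<le> (\<Sum>i\<in>UNIV. exp (real CARD('k) * K * z $ i) + exp (- real CARD('k) * K * z $ i))"
proof -
  have "\<exists>i. \<forall>j. \<bar>z $ j\<bar> \<le> \<bar>z $ i\<bar>"
  proof -
    have "Max (range (\<lambda>i. \<bar>z $ i\<bar>)) \<in> range (\<lambda>i. \<bar>z $ i\<bar>)"
      by (rule Max_in) auto
    then obtain i where "Max (range (\<lambda>i. \<bar>z $ i\<bar>)) = \<bar>z $ i\<bar>"
      by (rule imageE)
    moreover have "\<bar>z $ j\<bar> \<le> Max (range (\<lambda>i. \<bar>z $ i\<bar>))" for j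
      by (rule Max_ge) auto
    ultimately show ?thesis by auto
  qed
  then obtain i where i: "\<And>j. \<bar>z $ j\<bar> \<le> \<bar>z $ i\<bar>" by blast
  have "K \<ge> 0" using x[of i] by linarith
  have "x \<bullet> z \<le> (\<Sum>j\<in>(UNIV :: 'k set). K * \<bar>z $ i\<bar>)"
    unfolding inner_vec_def
  proof (rule sum_mono)
    fix j
    have "x $ j \<bullet> z $ j \<le> \<bar>x $ j\<bar> * \<bar>z $ j\<bar>"
      by (simp flip: abs_mult)
    also have "\<dots> \<le> K * \<bar>z $ i\<bar>"
      using x[of j] i[of j] \<open>K \<ge> 0\<close> by (intro mult_mono) auto
    finally show "x $ j \<bullet> z $ j \<le> K * \<bar>z $ i\<bar>" .
  qed
  also have "\<dots> = real CARD('k) * K * \<bar>z $ i\<bar>"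
    by simp
  finally have "exp (x \<bullet> z) \<le> exp (real CARD('k) * K * \<bar>z $ i\<bar>)"
    by simp
  also have "\<dots> \<le> exp (real CARD('k) * K * z $ i) + exp (- real CARD('k) * K * z $ i)"
    by (cases "z $ i \<ge> 0") (auto simp: abs_if)
  also have "\<dots> \<le> (\<Sum>i\<in>UNIV. exp (real CARD('k) * K * z $ i) + exp (- real CARD('k) * K * z $ i))"
    by (rule member_le_sum) (auto intro: add_nonneg_nonneg)
  finally show ?thesis .
qed

lemma exp_avg_le: "exp (u / 2 + v / 2) \<le> exp u + exp (v :: real)"
proof -
  have "exp (u / 2 + v / 2) \<le> exp (max u v)"
    by simp
  also have "\<dots> \<le> exp u + exp v"
    by (simp add: max_def)
  finally show ?thesis .
qed

text \<open>
  By \<open>exp_inner_le\<close> it is enough to bound the moment generating functions at finitely many multiples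
  of the unit vectors. These lie on the boundary of the positive cone or of its negative, and each is
  the mean of a vector in the interior of one of these cones and a vector in the interior of the other, to which
  the hypothesis applies.
\<close>

lemma mgf_limit_locally_bounded:
  fixes z :: "nat \<Rightarrow> 'j \<Rightarrow> real ^ 'k" and p :: "nat \<Rightarrow> 'j \<Rightarrow> real"
  assumes p: "\<And>n j. p n j \<ge> 0"
    and conv: "\<And>a \<tau>. (\<And>i. a $ i > 0) \<Longrightarrow> convergent (\<lambda>n. \<Sum>j\<in>S n. p n j * exp (\<tau> * (a \<bullet> z n j)))"
  shows "\<exists>C. \<forall>n x. (\<forall>i. \<bar>x $ i\<bar> \<le> K) \<longrightarrow> (\<Sum>j\<in>S n. p n j * exp (x \<bullet> z n j)) \<le> C"
proof -
  define G where "G = (\<lambda>n f. \<Sum>j\<in>S n. p n j * f (z n j))"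
  have G_mono: "G n f \<le> G n g" if "\<And>x. f x \<le> g x" for n f g
    unfolding G_def by (intro sum_mono mult_left_mono p that)
  have G_add: "G n (\<lambda>x. f x + g x) = G n f + G n g" for n f g
    by (simp add: G_def ring_distribs sum.distrib)
  have G_sum: "G n (\<lambda>x. \<Sum>i\<in>I. f i x) = (\<Sum>i\<in>I. G n (f i))" for n I and f :: "'k \<Rightarrow> real ^ 'k \<Rightarrow> real"
    unfolding G_def by (simp add: sum_distrib_left) (rule sum.swap)
  have pos_dir: "\<exists>C. \<forall>n. G n (\<lambda>x. exp (\<tau> * (a \<bullet> x))) \<le> C" if "\<And>i. a $ i > 0" for a \<tau>
  proof -
    have "Bseq (\<lambda>n. G n (\<lambda>x. exp (\<tau> * (a \<bullet> x))))"
      unfolding G_def by (intro convergent_imp_Bseq conv that)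
    then obtain C where "\<And>n. \<bar>G n (\<lambda>x. exp (\<tau> * (a \<bullet> x)))\<bar> \<le> C"
      by (auto simp: Bseq_def)
    then show ?thesis
      by (intro exI[of _ C] allI) (metis abs_le_D1)
  qed
  have coord: "\<exists>C. \<forall>n. G n (\<lambda>x. exp (c * x $ i)) \<le> C" for c i
  proof -
    define \<sigma> where "\<sigma> = (if c \<ge> 0 then 1 else -1 :: real)"
    define one where "one = ((\<chi> i. 1) :: real ^ 'k)"
    define a where "a = (2 * \<bar>c\<bar>) *\<^sub>R axis i 1 + one"
    have "a $ j > 0" for j
      by (auto simp: a_def one_def axis_def)
    from pos_dir[of a \<sigma>, OF this] obtain C where C: "\<And>n. G n (\<lambda>x. exp (\<sigma> * (a \<bullet> x))) \<le> C" by blast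
    from pos_dir[of one "- \<sigma>"] obtain D where D: "\<And>n. G n (\<lambda>x. exp (- \<sigma> * (one \<bullet> x))) \<le> D"
      by (auto simp: one_def)
    have "exp (c * x $ i) \<le> exp (\<sigma> * (a \<bullet> x)) + exp (- \<sigma> * (one \<bullet> x))" for x
    proof -
      have "c * x $ i = \<sigma> * (a \<bullet> x) / 2 + (- \<sigma> * (one \<bullet> x)) / 2"
        by (simp add: a_def \<sigma>_def inner_add_left inner_axis' algebra_simps)
      then show ?thesis
        using exp_avg_le by presburger
    qed
    then have "G n (\<lambda>x. exp (c * x $ i)) \<le> C + D" for n
      by (rule order_trans[OF G_mono]) (use C[of n] D[of n] in \<open>simp add: G_add\<close>)
    then show ?thesis by blast
  qed
  define c where "c = real CARD('k) * K"
  have "\<forall>i. \<exists>C. \<forall>n. G n (\<lambda>x. exp (c * x $ i)) + G n (\<lambda>x. exp (- c * x $ i)) \<le> C"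
    using coord by (meson add_mono)
  then obtain C where C: "\<And>i n. G n (\<lambda>x. exp (c * x $ i)) + G n (\<lambda>x. exp (- c * x $ i)) \<le> C i"
    by metis
  have "(\<Sum>j\<in>S n. p n j * exp (x \<bullet> z n j)) \<le> (\<Sum>i\<in>UNIV. C i)" if x: "\<forall>i. \<bar>x $ i\<bar> \<le> K" for n x
  proof -
    have "(\<Sum>j\<in>S n. p n j * exp (x \<bullet> z n j)) = G n (\<lambda>y. exp (x \<bullet> y))"
      by (simp add: G_def)
    also have "\<dots> \<le> G n (\<lambda>y. \<Sum>i\<in>UNIV. exp (c * y $ i) + exp (- c * y $ i))"
      using exp_inner_le[of x K] x by (intro G_mono) (simp add: c_def)
    also have "\<dots> \<le> (\<Sum>i\<in>UNIV. C i)"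
      unfolding G_sum G_add by (intro sum_mono C)
    finally show ?thesis .
  qed
  then show ?thesis by blast
qed

text \<open>
  Along the complex line \<open>a + \<tau> * b\<close> the moment generating functions are entire in \<open>\<tau>\<close>, and their modulus
  depends only on the real part of the argument, so the local bounds in real directions suffice for
  Vitali's theorem.
\<close>

lemma mgf_tendsto_along_complex_line:
  fixes z :: "nat \<Rightarrow> 'j \<Rightarrow> real ^ 'k" and p :: "nat \<Rightarrow> 'j \<Rightarrow> real" and A :: "real ^ 'k ^ 'k"
    and \<tau> :: complex
  assumes p: "\<And>n j. p n j \<ge> 0" and A: "transpose A = A"
    and bdd: "\<And>K. \<exists>C. \<forall>n x. (\<forall>i. \<bar>x $ i\<bar> \<le> K) \<longrightarrow> (\<Sum>j\<in>S n. p n j * exp (x \<bullet> z n j)) \<le> C"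
    and lim: "\<forall>\<^sub>F t in at 0. (\<lambda>n. \<Sum>j\<in>S n. p n j * exp ((a + t *\<^sub>R b) \<bullet> z n j)) \<longlonglongrightarrow> 
                exp ((a + t *\<^sub>R b) \<bullet> (A *v (a + t *\<^sub>R b)) / 2)"
  shows "(\<lambda>n. \<Sum>j\<in>S n. of_real (p n j) * exp (of_real (a \<bullet> z n j) + \<tau> * of_real (b \<bullet> z n j))) \<longlonglongrightarrow> 
           exp ((of_real (a \<bullet> (A *v a)) + 2 * \<tau> * of_real (a \<bullet> (A *v b)) + \<tau>\<^sup>2 * of_real (b \<bullet> (A *v b))) / 2)"
proof (rule entire_functions_tendsto_from_real_axis[where
      h = "\<lambda>n \<tau>. \<Sum>j\<in>S n. of_real (p n j) * exp (of_real (a \<bullet> z n j) + \<tau> * of_real (b \<bullet> z n j))"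
      and g = "\<lambda>\<tau>. exp ((of_real (a \<bullet> (A *v a)) + 2 * \<tau> * of_real (a \<bullet> (A *v b)) + \<tau>\<^sup>2 * of_real (b \<bullet> (A *v b))) / 2)"])
  fix R :: real
  from bdd obtain C where C: "\<And>n x. (\<forall>i. \<bar>x $ i\<bar> \<le> norm a + R * norm b) \<Longrightarrow> (\<Sum>j\<in>S n. p n j * exp (x \<bullet> z n j)) \<le> C"
    by meson
  have "norm (\<Sum>j\<in>S n. of_real (p n j) * exp (of_real (a \<bullet> z n j) + \<tau> * of_real (b \<bullet> z n j))) \<le> C"
    if "norm \<tau> \<le> R" for n and \<tau> :: complex
  proof -
    have "norm (\<Sum>j\<in>S n. of_real (p n j) * exp (of_real (a \<bullet> z n j) + \<tau> * of_real (b \<bullet> z n j)))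
      \<le> (\<Sum>j\<in>S n. norm (of_real (p n j) * exp (of_real (a \<bullet> z n j) + \<tau> * of_real (b \<bullet> z n j))))"
      by (rule norm_sum)
    also have "\<dots> = (\<Sum>j\<in>S n. p n j * exp ((a + Re \<tau> *\<^sub>R b) \<bullet> z n j))"
      using p by (intro sum.cong) (auto simp: norm_mult inner_add_left)
    also have "\<dots> \<le> C"
    proof (rule C, rule allI)
      fix i
      have "\<bar>(a + Re \<tau> *\<^sub>R b) $ i\<bar> \<le> norm (a + Re \<tau> *\<^sub>R b)"
        by (rule component_le_norm_cart)
      also have "\<dots> \<le> norm a + \<bar>Re \<tau>\<bar> * norm b"
        using norm_triangle_ineq[of a "Re \<tau> *\<^sub>R b"] by simp
      also have "\<dots> \<le> norm a + R * norm b"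
        using abs_Re_le_cmod[of \<tau>] that by (intro add_left_mono mult_right_mono) auto
      finally show "\<bar>(a + Re \<tau> *\<^sub>R b) $ i\<bar> \<le> norm a + R * norm b" .
    qed
    finally show ?thesis .
  qed
  then show "\<exists>C. \<forall>n. \<forall>\<tau> :: complex. norm \<tau> \<le> R \<longrightarrow>
      norm (\<Sum>j\<in>S n. of_real (p n j) * exp (of_real (a \<bullet> z n j) + \<tau> * of_real (b \<bullet> z n j))) \<le> C"
    by blast
next
  show "\<forall>\<^sub>F t in at 0. (\<lambda>n. \<Sum>j\<in>S n. of_real (p n j) * exp (of_real (a \<bullet> z n j) + complex_of_real t * of_real (b \<bullet> z n j)))
    \<longlonglongrightarrow> exp ((of_real (a \<bullet> (A *v a)) + 2 * complex_of_real t * of_real (a \<bullet> (A *v b)) + 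
              (complex_of_real t)\<^sup>2 * of_real (b \<bullet> (A *v b))) / 2)"
    using lim
  proof eventually_elim
    case (elim t)
    then have "(\<lambda>n. complex_of_real (\<Sum>j\<in>S n. p n j * exp ((a + t *\<^sub>R b) \<bullet> z n j))) \<longlonglongrightarrow> 
                complex_of_real (exp ((a + t *\<^sub>R b) \<bullet> (A *v (a + t *\<^sub>R b)) / 2))"
      unfolding tendsto_of_real_iff .
    then show ?case
      unfolding quadratic_form_line[OF A] by (simp add: inner_add_left flip: exp_of_real)
  qed
next
  show "(\<lambda>\<tau>. \<Sum>j\<in>S n. of_real (p n j) * exp (of_real (a \<bullet> z n j) + \<tau> * of_real (b \<bullet> z n j))) holomorphic_on UNIV" for n
    by (intro holomorphic_intros)
  show "(\<lambda>\<tau>. exp ((of_real (a \<bullet> (A *v a)) + 2 * \<tau> * of_real (a \<bullet> (A *v b)) + \<tau>\<^sup>2 * of_real (b \<bullet> (A *v b))) / 2))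
      holomorphic_on UNIV"
    by (rule holomorphic_intros | simp)+
qed

text \<open>
  Vitali's theorem is used on two kinds of lines. The line through \<open>(1, \<dots>, 1)\<close> and \<open>\<theta>\<close> starts in the
  interior of the positive cone and yields convergence at every real \<open>\<theta>\<close>; the line through \<open>0\<close> and \<open>\<theta>\<close> then yields
  convergence at \<open>\<i> * \<theta>\<close>.
\<close>

theorem char_tendsto_of_mgf_tendsto_positive:
  fixes z :: "nat \<Rightarrow> 'j \<Rightarrow> real ^ 'k" and p :: "nat \<Rightarrow> 'j \<Rightarrow> real" and A :: "real ^ 'k ^ 'k"
  assumes p: "\<And>n j. p n j \<ge> 0" and A: "transpose A = A"
    and lim: "\<And>a \<tau>. (\<And>i. a $ i > 0) \<Longrightarrow> (\<lambda>n. \<Sum>j\<in>S n. p n j * exp (\<tau> * (a \<bullet> z n j))) \<longlonglongrightarrow> 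
                exp (\<tau>\<^sup>2 * (a \<bullet> (A *v a)) / 2)"
  shows "(\<lambda>n. \<Sum>j\<in>S n. of_real (p n j) * iexp (\<theta> \<bullet> z n j)) \<longlonglongrightarrow> of_real (exp (- (\<theta> \<bullet> (A *v \<theta>)) / 2))"
proof -
  have bdd: "\<exists>C. \<forall>n x. (\<forall>i. \<bar>x $ i\<bar> \<le> K) \<longrightarrow> (\<Sum>j\<in>S n. p n j * exp (x \<bullet> z n j)) \<le> C" for K
  proof (rule mgf_limit_locally_bounded)
    show "convergent (\<lambda>n. \<Sum>j\<in>S n. p n j * exp (\<tau> * (a \<bullet> z n j)))" if "\<And>i. a $ i > 0" for a \<tau>
      using lim[OF that] by (rule convergentI)
  qed (rule p)
  have real: "(\<lambda>n. \<Sum>j\<in>S n. p n j * exp (\<theta> \<bullet> z n j)) \<longlonglongrightarrow> exp (\<theta> \<bullet> (A *v \<theta>) / 2)" for \<theta>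
  proof -
    define a where "a = ((\<chi> i. 1) :: real ^ 'k)"
    define b where "b = \<theta> - a"
    have "\<forall>\<^sub>F t in at 0. \<forall>i. (a + t *\<^sub>R b) $ i > 0"
    proof (rule eventually_all_finite)
      fix i
      have "((\<lambda>t. a $ i + t * b $ i) \<longlongrightarrow> a $ i + 0 * b $ i) (at 0)"
        by (intro tendsto_intros)
      then show "\<forall>\<^sub>F t in at 0. (a + t *\<^sub>R b) $ i > 0"
        by (auto simp: a_def dest: order_tendstoD(1)[where a = 0])
    qed
    then have "\<forall>\<^sub>F t in at 0. (\<lambda>n. \<Sum>j\<in>S n. p n j * exp ((a + t *\<^sub>R b) \<bullet> z n j)) \<longlonglongrightarrow> 
                exp ((a + t *\<^sub>R b) \<bullet> (A *v (a + t *\<^sub>R b)) / 2)"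
      by eventually_elim (use lim[where \<tau> = 1] in simp)
    from mgf_tendsto_along_complex_line[OF p A bdd this, where \<tau> = 1]
    have "(\<lambda>n. complex_of_real (\<Sum>j\<in>S n. p n j * exp (a \<bullet> z n j + b \<bullet> z n j))) \<longlonglongrightarrow> 
      complex_of_real (exp ((a \<bullet> (A *v a) + 2 * 1 * (a \<bullet> (A *v b)) + 1\<^sup>2 * (b \<bullet> (A *v b))) / 2))"
      by (simp flip: exp_of_real)
    then show ?thesis
      unfolding tendsto_of_real_iff quadratic_form_line[OF A, of a 1 b, symmetric] inner_add_left[symmetric]
      by (simp add: b_def)
  qed
  have "\<forall>\<^sub>F t in at 0. (\<lambda>n. \<Sum>j\<in>S n. p n j * exp ((0 + t *\<^sub>R \<theta>) \<bullet> z n j)) \<longlonglongrightarrow> 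
                exp ((0 + t *\<^sub>R \<theta>) \<bullet> (A *v (0 + t *\<^sub>R \<theta>)) / 2)"
    by (intro always_eventually allI real)
  from mgf_tendsto_along_complex_line[OF p A bdd this, where \<tau> = \<i>]
  show ?thesis
    by (simp flip: exp_of_real)
qed

section \<open>Random vectors with real stable generating functions\<close>

lemma finite_range_expectation:
  fixes g :: "'b \<Rightarrow> 'c::{banach, second_countable_topology}"
  assumes "prob_space M" "finite B" and Y: "\<And>\<omega>. \<omega> \<in> space M \<Longrightarrow> Y \<omega> \<in> B"
    and meas: "Y \<in> measurable M (count_space UNIV)"
  shows integrable_finite_range: "integrable M (\<lambda>\<omega>. g (Y \<omega>))"
    and integral_finite_range: "(\<integral>\<omega>. g (Y \<omega>) \<partial>M) = (\<Sum>j\<in>B. measure M {\<omega> \<in> space M. Y \<omega> = j} *\<^sub>R g j)"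
proof -
  interpret prob_space M by fact
  have sets: "{\<omega> \<in> space M. Y \<omega> = j} \<in> sets M" for j
    using measurable_sets[OF meas, of "{j}"] by (simp add: vimage_def Int_def conj_commute)
  have "has_bochner_integral M (\<lambda>\<omega>. \<Sum>j\<in>B. indicator {\<omega> \<in> space M. Y \<omega> = j} \<omega> *\<^sub>R g j)
          (\<Sum>j\<in>B. measure M {\<omega> \<in> space M. Y \<omega> = j} *\<^sub>R g j)"
    by (intro has_bochner_integral_sum has_bochner_integral_scaleR_left has_bochner_integral_real_indicator sets)
       (simp add: emeasure_eq_measure)
  moreover have "(\<Sum>j\<in>B. indicator {\<omega> \<in> space M. Y \<omega> = j} \<omega> *\<^sub>R g j) = g (Y \<omega>)" if "\<omega> \<in> space M" for \<omega>
  proof -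
    have "(\<Sum>j\<in>B. indicator {\<omega> \<in> space M. Y \<omega> = j} \<omega> *\<^sub>R g j) = (\<Sum>j\<in>B. if j = Y \<omega> then g j else 0)"
      using that by (intro sum.cong) auto
    then show ?thesis
      using Y[OF that] \<open>finite B\<close> by simp
  qed
  ultimately have "has_bochner_integral M (\<lambda>\<omega>. g (Y \<omega>)) (\<Sum>j\<in>B. measure M {\<omega> \<in> space M. Y \<omega> = j} *\<^sub>R g j)"
    by (subst has_bochner_integral_cong[OF refl _ refl, symmetric]) auto
  then show "integrable M (\<lambda>\<omega>. g (Y \<omega>))"
    and "(\<integral>\<omega>. g (Y \<omega>) \<partial>M) = (\<Sum>j\<in>B. measure M {\<omega> \<in> space M. Y \<omega> = j} *\<^sub>R g j)"
    by (simp_all add: has_bochner_integral_iff)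
qed

lemma finite_nat_cube: "finite {j :: nat ^ 'k. \<forall>i. j $ i \<le> n}"
proof (rule finite_subset)
  show "{j :: nat ^ 'k. \<forall>i. j $ i \<le> n} \<subseteq> vec_lambda ` (PiE UNIV (\<lambda>_. {..n}))"
  proof
    fix j :: "nat ^ 'k" assume "j \<in> {j. \<forall>i. j $ i \<le> n}"
    then show "j \<in> vec_lambda ` (PiE UNIV (\<lambda>_. {..n}))"
      by (intro image_eqI[of _ _ "vec_nth j"]) auto
  qed
qed (intro finite_imageI finite_PiE; simp)

locale bounded_random_vector = prob_space M for M :: "'a measure" +
  fixes Y :: "'a \<Rightarrow> nat ^ 'k" and n :: nat
  assumes measurable_Y: "Y \<in> measurable M (count_space UNIV)"
    and Y_le: "\<omega> \<in> space M \<Longrightarrow> Y \<omega> $ i \<le> n"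
begin

abbreviation "cube \<equiv> {j :: nat ^ 'k. \<forall>i. j $ i \<le> n}"

definition pr :: "nat ^ 'k \<Rightarrow> real" where
  "pr j = measure M {\<omega> \<in> space M. Y \<omega> = j}"

abbreviation "m \<equiv> mean M (\<lambda>\<omega>. real_vec (Y \<omega>))"
abbreviation "Cov \<equiv> covariance_matrix M (\<lambda>\<omega>. real_vec (Y \<omega>))"

lemma pr_nonneg: "pr j \<ge> 0"
  by (simp add: pr_def)

lemma
  fixes g :: "nat ^ 'k \<Rightarrow> 'c::{banach, second_countable_topology}"
  shows integrable_Y: "integrable M (\<lambda>\<omega>. g (Y \<omega>))"
    and integral_Y: "(\<integral>\<omega>. g (Y \<omega>) \<partial>M) = (\<Sum>j\<in>cube. pr j *\<^sub>R g j)"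
  using finite_range_expectation[OF prob_space_axioms finite_nat_cube _ measurable_Y, of n g] Y_le
  by (auto simp: pr_def)

lemma sum_pr: "sum pr cube = 1"
  using integral_Y[of "\<lambda>_. 1 :: real"] by (simp add: prob_space)

lemma inner_mean: "a \<bullet> m = (\<Sum>j\<in>cube. pr j * (a \<bullet> real_vec j))"
  by (simp add: mean_def integral_Y inner_sum_right)

lemma covariance_matrix_component: 
  "Cov $ i $ j = (\<Sum>l\<in>cube. pr l * ((real_vec l - m) $ i * (real_vec l - m) $ j))"
  using integral_Y[of "\<lambda>y. (real_vec y $ i - m $ i) * (real_vec y $ j - m $ j)"]
  by (simp add: covariance_matrix_def)

lemma transpose_Cov: "transpose Cov = Cov"
  by (simp add: transpose_def vec_eq_iff covariance_matrix_component mult.commute)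

lemma inner_Cov: "a \<bullet> (Cov *v a) = (\<Sum>l\<in>cube. pr l * (a \<bullet> (real_vec l - m))\<^sup>2)"
proof -
  have "a \<bullet> (Cov *v a) = (\<Sum>i\<in>UNIV. \<Sum>j\<in>UNIV. \<Sum>l\<in>cube. pr l * (a $ i * (real_vec l - m) $ i) * (a $ j * (real_vec l - m) $ j))"
    unfolding inner_vec_def matrix_vector_mult_def covariance_matrix_component
    by (simp add: sum_distrib_left sum_distrib_right mult_ac)
  also have "\<dots> = (\<Sum>l\<in>cube. \<Sum>i\<in>UNIV. \<Sum>j\<in>UNIV. pr l * (a $ i * (real_vec l - m) $ i) * (a $ j * (real_vec l - m) $ j))"
    by (simp only: sum.swap[of _ cube])
  also have "\<dots> = (\<Sum>l\<in>cube. pr l * (a \<bullet> (real_vec l - m))\<^sup>2)"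
  proof (rule sum.cong[OF refl])
    fix l :: "nat ^ 'k"
    define f where "f = (\<lambda>i. a $ i * (real_vec l - m) $ i)"
    have f_eq: "f i = a $ i * (real_vec l - m) $ i" for i
      by (simp add: f_def)
    have "a \<bullet> (real_vec l - m) = (\<Sum>i\<in>UNIV. f i)"
      by (simp add: inner_vec_def f_def)
    then show "(\<Sum>i\<in>UNIV. \<Sum>j\<in>UNIV. pr l * (a $ i * (real_vec l - m) $ i) * (a $ j * (real_vec l - m) $ j)) =
        pr l * (a \<bullet> (real_vec l - m))\<^sup>2"
      unfolding f_eq[symmetric] power2_eq_square
      by (simp only:) (subst sum_product, simp only: sum_distrib_left mult.assoc)
  qed
  finally show ?thesis .
qed

lemma inner_Cov_eq_second_moment_minus: 
  "a \<bullet> (Cov *v a) = (\<Sum>j\<in>cube. pr j * (a \<bullet> real_vec j)\<^sup>2) - (a \<bullet> m)\<^sup>2"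
proof -
  let ?\<mu> = "a \<bullet> m"
  have "a \<bullet> (Cov *v a) = (\<Sum>j\<in>cube. pr j * (a \<bullet> real_vec j)\<^sup>2 - 2 * ?\<mu> * (pr j * (a \<bullet> real_vec j)) + pr j * ?\<mu>\<^sup>2)"
    unfolding inner_Cov by (intro sum.cong) (auto simp: inner_diff_right power2_eq_square algebra_simps)
  also have "\<dots> = (\<Sum>j\<in>cube. pr j * (a \<bullet> real_vec j)\<^sup>2) - 2 * ?\<mu> * ?\<mu> + ?\<mu>\<^sup>2"
    unfolding inner_mean[of a] sum.distrib sum_subtractf sum_distrib_left[symmetric] sum_distrib_right[symmetric] sum_pr
    by simp
  finally show ?thesis by (simp add: power2_eq_square)
qed

lemma prob_gen_fun_exp:
  "prob_gen_fun n M Y (\<chi> i. exp (t * of_real (a $ i))) = mgf cube pr (\<lambda>j. a \<bullet> real_vec j) t"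
proof -
  have "(\<Prod>i\<in>UNIV. exp (t * of_real (a $ i)) ^ (j $ i)) = exp (of_real (a \<bullet> real_vec j) * t)" for j
    by (simp add: inner_vec_def real_vec_def sum_distrib_left sum_distrib_right mult_ac
        flip: exp_of_nat_mult exp_sum)
  then show ?thesis
    by (simp add: prob_gen_fun_def mgf_def pr_def)
qed

text \<open>
  For \<open>t\<close> in the strip each \<open>t * a $ i\<close> has imaginary part strictly between \<open>0\<close> and \<open>pi\<close>, so the point
  at which the generating function is evaluated has all coordinates in the upper half plane.
\<close>

lemma mgf_nonzero_if_real_stable:
  assumes stable: "real_stable (prob_gen_fun n M Y)" and a: "\<And>i. a $ i > 0"
    and t: "0 < Im t" "Im t < pi / (\<Sum>i\<in>UNIV. a $ i)"
  shows "mgf cube pr (\<lambda>j. a \<bullet> real_vec j) t \<noteq> 0"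
proof
  assume "mgf cube pr (\<lambda>j. a \<bullet> real_vec j) t = 0"
  then obtain i where "Im (exp (t * of_real (a $ i))) \<le> 0"
    using stable unfolding real_stable_def prob_gen_fun_exp[symmetric] by force
  moreover have "Im (exp (t * of_real (a $ i))) > 0"
  proof -
    have "(\<Sum>i\<in>UNIV. a $ i) > 0"
      using a by (intro sum_pos) auto
    moreover have "a $ i \<le> (\<Sum>i\<in>UNIV. a $ i)"
      using a by (intro member_le_sum) (auto intro: less_imp_le)
    then have "Im t * a $ i \<le> Im t * (\<Sum>i\<in>UNIV. a $ i)"
      using t by (intro mult_left_mono) auto
    ultimately have "Im t * a $ i < pi"
      using t(2) by (simp add: pos_less_divide_eq)
    then show ?thesis
      using t(1) a[of i] by (simp add: Im_exp sin_gt_zero)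
  qed
  ultimately show False by simp
qed

text \<open>
  The general estimate applied to \<open>a \<bullet> Y\<close>. Points of mass \<open>0\<close> are discarded first, because that estimate
  needs positive masses.
\<close>

lemma centred_projection_gaussian_approximation:
  fixes t :: complex
  assumes stable: "real_stable (prob_gen_fun n M Y)" and a: "\<And>i. a $ i > 0"
    and \<rho>: "0 < \<rho>" "\<rho> < pi / (\<Sum>i\<in>UNIV. a $ i)" and t: "norm t \<le> \<rho> / 2"
  shows "\<exists>e. (\<integral>\<omega>. exp (t * of_real (a \<bullet> (real_vec (Y \<omega>) - m))) \<partial>M) = exp (of_real (a \<bullet> (Cov *v a)) * t\<^sup>2 / 2 + e)
           \<and> norm e \<le> 6 * (a \<bullet> (Cov *v a)) * norm t ^ 3 / \<rho>"
proof -
  define S where "S = {j \<in> cube. pr j > 0}"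
  define x where "x = (\<lambda>j. a \<bullet> real_vec j :: real)"
  have sum_S: "(\<Sum>j\<in>S. f (pr j) j) = (\<Sum>j\<in>cube. f (pr j) j)" if "\<And>j. f 0 j = 0"
    for f :: "real \<Rightarrow> nat ^ 'k \<Rightarrow> 'z::comm_monoid_add"
    unfolding S_def
    by (rule sum.mono_neutral_left) (use finite_nat_cube that pr_nonneg in \<open>auto simp: less_le\<close>)
  have mgf_S: "mgf S pr x s = mgf cube pr x s" for s
    unfolding mgf_def by (rule sum_S[of "\<lambda>p j. of_real p * exp (of_real (x j) * s)"]) simp
  have sum_1: "sum pr S = 1"
    using sum_S[of "\<lambda>p j. p"] sum_pr by simp
  have "finite S"
    unfolding S_def by (rule finite_subset[OF _ finite_nat_cube]) auto
  have "S \<noteq> {}"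
    using sum_1 by auto
  have pos: "pr j > 0" if "j \<in> S" for j
    using that by (simp add: S_def)
  have nz: "mgf S pr x s \<noteq> 0" if "0 < Im s" "Im s < pi / (\<Sum>i\<in>UNIV. a $ i)" for s
    unfolding mgf_S unfolding x_def by (rule mgf_nonzero_if_real_stable[OF stable a that])
  have means: "(\<Sum>j\<in>S. pr j * x j) = a \<bullet> m" "(\<Sum>j\<in>S. pr j * (x j)\<^sup>2) - (a \<bullet> m)\<^sup>2 = a \<bullet> (Cov *v a)"
    using sum_S[of "\<lambda>p j. p * x j"] sum_S[of "\<lambda>p j. p * (x j)\<^sup>2"]
    by (simp_all add: inner_mean inner_Cov_eq_second_moment_minus x_def)
  obtain e where e: "mgf S pr x t = exp (of_real (a \<bullet> m) * t + of_real (a \<bullet> (Cov *v a)) * t\<^sup>2 / 2 + e)"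
    "norm e \<le> 6 * (a \<bullet> (Cov *v a)) * norm t ^ 3 / \<rho>"
    by (rule mgf_gaussian_approximation[OF \<open>finite S\<close> \<open>S \<noteq> {}\<close> pos sum_1 nz \<rho> t, unfolded means])
  have "(\<integral>\<omega>. exp (t * of_real (a \<bullet> (real_vec (Y \<omega>) - m))) \<partial>M) =
        (\<Sum>j\<in>cube. pr j *\<^sub>R exp (t * of_real (a \<bullet> (real_vec j - m))))"
    by (rule integral_Y)
  also have "\<dots> = mgf S pr x t * exp (- of_real (a \<bullet> m) * t)"
    unfolding mgf_S unfolding mgf_def x_def sum_distrib_right
    by (intro sum.cong refl) (simp add: scaleR_conv_of_real inner_diff_right algebra_simps flip: exp_add)
  also have "\<dots> = exp (of_real (a \<bullet> (Cov *v a)) * t\<^sup>2 / 2 + e)"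
    unfolding e by (simp add: algebra_simps flip: exp_add)
  finally show ?thesis
    using e(2) by blast
qed

end

text \<open>
  The approximation is used at \<open>t = \<tau> / s n\<close>, which eventually lies in the disc where it is valid. The
  error is of order \<open>V n * \<bar>\<tau>\<bar> ^ 3 / s n\<close>, where the scaled variances \<open>V n\<close> converge, so it vanishes even if
  the limit of \<open>V n\<close> is \<open>0\<close>.
\<close>

lemma scaled_mgf_tendsto_gaussian:
  fixes Y :: "nat \<Rightarrow> 'a \<Rightarrow> nat ^ 'k" and A :: "real ^ 'k ^ 'k" and \<tau> :: real
  assumes Y: "\<And>n. bounded_random_vector (M n) (Y n) (b n)"
    and stable: "\<And>n. real_stable (prob_gen_fun (b n) (M n) (Y n))"
    and s: "\<And>n. s n > 0" "filterlim s at_top sequentially"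
    and A: "(\<lambda>n. (1 / (s n)\<^sup>2) *\<^sub>R covariance_matrix (M n) (\<lambda>\<omega>. real_vec (Y n \<omega>))) \<longlonglongrightarrow> A"
    and a: "\<And>i. a $ i > 0"
  shows "(\<lambda>n. \<integral>\<omega>. exp (\<tau> * (a \<bullet> ((1 / s n) *\<^sub>R (real_vec (Y n \<omega>) - mean (M n) (\<lambda>\<omega>. real_vec (Y n \<omega>)))))) \<partial>M n)
           \<longlonglongrightarrow> exp (\<tau>\<^sup>2 * (a \<bullet> (A *v a)) / 2)"
proof -
  define C where "C = (\<lambda>n. covariance_matrix (M n) (\<lambda>\<omega>. real_vec (Y n \<omega>)))"
  define X where "X = (\<lambda>n \<omega>. real_vec (Y n \<omega>) - mean (M n) (\<lambda>\<omega>. real_vec (Y n \<omega>)))"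
  define V where "V = (\<lambda>n. a \<bullet> (C n *v a) / (s n)\<^sup>2)"
  define t where "t = (\<lambda>n. complex_of_real (\<tau> / s n))"
  \<comment> \<open>half the width of the zero-free strip; it does not depend on \<open>n\<close>\<close>
  define \<rho> where "\<rho> = pi / (2 * (\<Sum>i\<in>UNIV. a $ i))"
  have "(\<Sum>i\<in>UNIV. a $ i) > 0"
    using a by (intro sum_pos) auto
  then have \<rho>: "0 < \<rho>" "\<rho> < pi / (\<Sum>i\<in>UNIV. a $ i)"
    by (auto simp: \<rho>_def field_simps)
  have V: "V \<longlonglongrightarrow> a \<bullet> (A *v a)"
  proof -
    have "(\<lambda>n. a \<bullet> (((1 / (s n)\<^sup>2) *\<^sub>R C n) *v a)) \<longlonglongrightarrow> a \<bullet> (A *v a)"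
      unfolding inner_vec_def matrix_vector_mult_def inner_real_def C_def vec_lambda_beta
      by (intro tendsto_intros tendsto_vec_nth A)
    then show ?thesis
      by (simp add: V_def scaleR_matrix_vector_assoc[symmetric])
  qed
  have inv: "(\<lambda>n. 1 / s n) \<longlonglongrightarrow> 0"
    using tendsto_inverse_0_at_top[OF s(2)] by (simp add: inverse_eq_divide)
  have "\<forall>n. \<exists>e. norm (t n) \<le> \<rho> / 2 \<longrightarrow>
     (\<integral>\<omega>. exp (t n * of_real (a \<bullet> X n \<omega>)) \<partial>M n) = exp (of_real (a \<bullet> (C n *v a)) * (t n)\<^sup>2 / 2 + e)
           \<and> norm e \<le> 6 * (a \<bullet> (C n *v a)) * norm (t n) ^ 3 / \<rho>"
    using bounded_random_vector.centred_projection_gaussian_approximation[OF Y stable a \<rho>]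
    unfolding C_def X_def by blast
  then obtain e where e: "\<And>n. norm (t n) \<le> \<rho> / 2 \<Longrightarrow>
     (\<integral>\<omega>. exp (t n * of_real (a \<bullet> X n \<omega>)) \<partial>M n) = exp (of_real (a \<bullet> (C n *v a)) * (t n)\<^sup>2 / 2 + e n)"
    "\<And>n. norm (t n) \<le> \<rho> / 2 \<Longrightarrow> norm (e n) \<le> 6 * (a \<bullet> (C n *v a)) * norm (t n) ^ 3 / \<rho>"
    by metis
  have t_small: "\<forall>\<^sub>F n in sequentially. norm (t n) \<le> \<rho> / 2"
  proof -
    have "(\<lambda>n. \<bar>\<tau>\<bar> * (1 / s n)) \<longlonglongrightarrow> \<bar>\<tau>\<bar> * 0"
      by (intro tendsto_intros inv)
    then have "\<forall>\<^sub>F n in sequentially. \<bar>\<tau>\<bar> * (1 / s n) < \<rho> / 2"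
      using \<rho>(1) by (intro order_tendstoD) auto
    then show ?thesis
      by eventually_elim (use s(1) in \<open>simp add: t_def norm_divide less_imp_le\<close>)
  qed
  have "e \<longlonglongrightarrow> 0"
  proof (rule Lim_null_comparison)
    show "\<forall>\<^sub>F n in sequentially. norm (e n) \<le> 6 * V n * \<bar>\<tau>\<bar> ^ 3 * (1 / s n) / \<rho>"
      using t_small
    proof eventually_elim
      case (elim n)
      have "6 * (a \<bullet> (C n *v a)) * norm (t n) ^ 3 / \<rho> = 6 * V n * \<bar>\<tau>\<bar> ^ 3 * (1 / s n) / \<rho>"
        using s(1)[of n] by (simp add: V_def t_def norm_divide power_divide power3_eq_cube power2_eq_square)
      with e(2)[OF elim] show ?case by simp
    qed
    have "(\<lambda>n. 6 * V n * \<bar>\<tau>\<bar> ^ 3 * (1 / s n) / \<rho>) \<longlonglongrightarrow> 6 * (a \<bullet> (A *v a)) * \<bar>\<tau>\<bar> ^ 3 * 0 / \<rho>"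
      by (intro tendsto_intros V inv) (use \<rho> in auto)
    then show "(\<lambda>n. 6 * V n * \<bar>\<tau>\<bar> ^ 3 * (1 / s n) / \<rho>) \<longlonglongrightarrow> 0"
      by simp
  qed
  then have "(\<lambda>n. exp (of_real (V n * \<tau>\<^sup>2 / 2) + e n)) \<longlonglongrightarrow> exp (of_real ((a \<bullet> (A *v a)) * \<tau>\<^sup>2 / 2) + 0)"
    by (intro tendsto_intros V) auto
  moreover have "\<forall>\<^sub>F n in sequentially. exp (of_real (V n * \<tau>\<^sup>2 / 2) + e n) =
      complex_of_real (\<integral>\<omega>. exp (\<tau> * (a \<bullet> ((1 / s n) *\<^sub>R X n \<omega>))) \<partial>M n)"
    using t_small
  proof eventually_elim
    case (elim n)
    have "complex_of_real (\<integral>\<omega>. exp (\<tau> * (a \<bullet> ((1 / s n) *\<^sub>R X n \<omega>))) \<partial>M n) =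
          (\<integral>\<omega>. exp (t n * of_real (a \<bullet> X n \<omega>)) \<partial>M n)"
      by (simp add: t_def exp_of_real[symmetric] flip: integral_complex_of_real)
    also have "\<dots> = exp (of_real (V n * \<tau>\<^sup>2 / 2) + e n)"
      unfolding e(1)[OF elim] by (simp add: V_def t_def power_divide)
    finally show ?case by simp
  qed
  ultimately have "(\<lambda>n. complex_of_real (\<integral>\<omega>. exp (\<tau> * (a \<bullet> ((1 / s n) *\<^sub>R X n \<omega>))) \<partial>M n)) \<longlonglongrightarrow>
      complex_of_real (exp (\<tau>\<^sup>2 * (a \<bullet> (A *v a)) / 2))"
    unfolding exp_of_real[symmetric] add_0_right mult.commute[of "\<tau>\<^sup>2"] by (rule Lim_transform_eventually)
  then show ?thesis
    unfolding tendsto_of_real_iff X_def .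
qed

lemma tight_of_second_moments:
  fixes X :: "nat \<Rightarrow> 'a \<Rightarrow> real ^ 'k"
  assumes M: "\<And>n. prob_space (M n)" and X: "\<And>n. X n \<in> borel_measurable (M n)"
    and int: "\<And>n i. integrable (M n) (\<lambda>\<omega>. (X n \<omega> $ i)\<^sup>2)"
    and K: "\<And>n i. (\<integral>\<omega>. (X n \<omega> $ i)\<^sup>2 \<partial>M n) \<le> K" and "\<eta> > 0"
  shows "\<forall>\<^sub>F R in at_top. \<forall>n. measure (M n) {\<omega> \<in> space (M n). \<exists>i. R < \<bar>X n \<omega> $ i\<bar>} \<le> \<eta>"
proof -
  have "((\<lambda>R. real CARD('k) * K / R\<^sup>2) \<longlongrightarrow> 0) at_top"
    by real_asymp
  then have "\<forall>\<^sub>F R in at_top. real CARD('k) * K / R\<^sup>2 < \<eta>"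
    using \<open>\<eta> > 0\<close> by (rule order_tendstoD)
  then show ?thesis
    using eventually_gt_at_top[of 0]
  proof eventually_elim
    case (elim R)
    show ?case
    proof
      fix n
      interpret prob_space "M n" by fact
      have meas: "(\<lambda>\<omega>. X n \<omega> $ i) \<in> borel_measurable (M n)" for i
        by (rule measurable_compose[OF X borel_measurable_nth])
      have sets: "{\<omega> \<in> space (M n). R\<^sup>2 \<le> (X n \<omega> $ i)\<^sup>2} \<in> sets (M n)" for i
        by (intro borel_measurable_le borel_measurable_power meas) simp
      have "measure (M n) {\<omega> \<in> space (M n). \<exists>i. R < \<bar>X n \<omega> $ i\<bar>}
          \<le> measure (M n) (\<Union>i. {\<omega> \<in> space (M n). R\<^sup>2 \<le> (X n \<omega> $ i)\<^sup>2})"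
      proof (rule finite_measure_mono)
        show "{\<omega> \<in> space (M n). \<exists>i. R < \<bar>X n \<omega> $ i\<bar>} \<subseteq> (\<Union>i. {\<omega> \<in> space (M n). R\<^sup>2 \<le> (X n \<omega> $ i)\<^sup>2})"
          using elim by (fastforce simp: abs_le_square_iff[symmetric] intro: less_imp_le)
      qed (use sets in auto)
      also have "\<dots> \<le> (\<Sum>i\<in>UNIV. measure (M n) {\<omega> \<in> space (M n). R\<^sup>2 \<le> (X n \<omega> $ i)\<^sup>2})"
        by (rule finite_measure_subadditive_finite) (use sets in auto)
      also have "\<dots> \<le> (\<Sum>i\<in>(UNIV :: 'k set). K / R\<^sup>2)"
      proof (rule sum_mono)
        fix i
        have "measure (M n) {\<omega> \<in> space (M n). R\<^sup>2 \<le> (X n \<omega> $ i)\<^sup>2} \<le> (\<integral>\<omega>. (X n \<omega> $ i)\<^sup>2 \<partial>M n) / R\<^sup>2"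
          by (rule integral_Markov_inequality_measure[OF int]) (use elim in auto)
        also have "\<dots> \<le> K / R\<^sup>2"
          by (intro divide_right_mono K) simp
        finally show "measure (M n) {\<omega> \<in> space (M n). R\<^sup>2 \<le> (X n \<omega> $ i)\<^sup>2} \<le> K / R\<^sup>2" .
      qed
      also have "\<dots> \<le> \<eta>"
        using elim by simp
      finally show "measure (M n) {\<omega> \<in> space (M n). \<exists>i. R < \<bar>X n \<omega> $ i\<bar>} \<le> \<eta>" .
    qed
  qed
qed

text \<open>
  The three parts of the argument are put together here. The limit \<open>A\<close> inherits symmetry and
  nonnegativity from the covariance matrices, so \<open>centred_gaussian A\<close> has the expected
  characteristic function; tightness holds because the second moments of the scaled vectors are
  the diagonal entries of the scaled covariance matrices.
\<close>

theorem real_stable_central_limit: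
  fixes Y :: "nat \<Rightarrow> 'a \<Rightarrow> nat ^ 'k" and A :: "real ^ 'k ^ 'k"
  assumes Y: "\<And>n. bounded_random_vector (M n) (Y n) (b n)"
    and stable: "\<And>n. real_stable (prob_gen_fun (b n) (M n) (Y n))"
    and s: "\<And>n. s n > 0" "filterlim s at_top sequentially"
    and A: "(\<lambda>n. (1 / (s n)\<^sup>2) *\<^sub>R covariance_matrix (M n) (\<lambda>\<omega>. real_vec (Y n \<omega>))) \<longlonglongrightarrow> A"
  shows "converges_in_distribution M
           (\<lambda>n \<omega>. (1 / s n) *\<^sub>R (real_vec (Y n \<omega>) - mean (M n) (\<lambda>\<omega>. real_vec (Y n \<omega>))))
           (centred_gaussian A)"
proof -
  define C where "C = (\<lambda>n. covariance_matrix (M n) (\<lambda>\<omega>. real_vec (Y n \<omega>)))"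
  define x where "x = (\<lambda>n j. (1 / s n) *\<^sub>R (real_vec j - mean (M n) (\<lambda>\<omega>. real_vec (Y n \<omega>))))"
  define p where "p = (\<lambda>n. bounded_random_vector.pr (M n) (Y n))"
  have M: "prob_space (M n)" for n
    using Y[of n] by (simp add: bounded_random_vector_def)
  have p: "bounded_random_vector.pr (M n) (Y n) = p n" for n
    by (simp add: p_def)
  note integral = bounded_random_vector.integral_Y[OF Y, unfolded p]
  have X: "(\<lambda>\<omega>. x n (Y n \<omega>)) \<in> borel_measurable (M n)" for n
    using Y[of n] by (intro measurable_compose[OF bounded_random_vector.measurable_Y[of _ "Y n"]]) auto
  have C_lim: "(\<lambda>n. C n $ i $ j / (s n)\<^sup>2) \<longlonglongrightarrow> A $ i $ j" for i j
    using tendsto_vec_nth[OF tendsto_vec_nth[OF A], of i j] by (simp add: C_def)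
  have A_sym: "transpose A = A"
  proof -
    have "A $ i $ j = A $ j $ i" for i j
    proof (rule LIMSEQ_unique[OF C_lim])
      have "C n $ i $ j = C n $ j $ i" for n
        using arg_cong[OF bounded_random_vector.transpose_Cov[OF Y[of n]], of "\<lambda>B. B $ j $ i"]
        by (simp add: C_def transpose_def)
      then show "(\<lambda>n. C n $ i $ j / (s n)\<^sup>2) \<longlonglongrightarrow> A $ j $ i"
        using C_lim by simp
    qed
    then show ?thesis by (simp add: transpose_def vec_eq_iff)
  qed
  have A_psd: "v \<bullet> (A *v v) \<ge> 0" for v
  proof (rule LIMSEQ_le_const)
    show "(\<lambda>n. \<Sum>i\<in>UNIV. v $ i * (\<Sum>j\<in>UNIV. C n $ i $ j / (s n)\<^sup>2 * v $ j)) \<longlonglongrightarrow> v \<bullet> (A *v v)"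
      unfolding inner_vec_def matrix_vector_mult_def inner_real_def vec_lambda_beta
      by (intro tendsto_intros C_lim)
    have "(\<Sum>i\<in>UNIV. v $ i * (\<Sum>j\<in>UNIV. C n $ i $ j / (s n)\<^sup>2 * v $ j)) = v \<bullet> (C n *v v) / (s n)\<^sup>2" for n
      by (simp add: inner_vec_def matrix_vector_mult_def sum_distrib_left sum_divide_distrib)
    moreover have "v \<bullet> (C n *v v) \<ge> 0" for n
      unfolding C_def bounded_random_vector.inner_Cov[OF Y]
      by (intro sum_nonneg mult_nonneg_nonneg bounded_random_vector.pr_nonneg[OF Y]) auto
    ultimately show "\<exists>N. \<forall>n\<ge>N. 0 \<le> (\<Sum>i\<in>UNIV. v $ i * (\<Sum>j\<in>UNIV. C n $ i $ j / (s n)\<^sup>2 * v $ j))"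
      by simp
  qed
  note B = psd_matrix_square_root[OF A_sym A_psd]
  have "converges_in_distribution M (\<lambda>n \<omega>. x n (Y n \<omega>)) (centred_gaussian A)"
  proof (rule converges_in_distribution_if_char[OF M X prob_space_centred_gaussian[OF B] sets_centred_gaussian[OF B]])
    fix \<theta>
    have "(\<lambda>n. \<Sum>j | \<forall>i. j $ i \<le> b n. of_real (p n j) * iexp (\<theta> \<bullet> x n j)) \<longlonglongrightarrow> 
            complex_of_real (exp (- (\<theta> \<bullet> (A *v \<theta>)) / 2))"
    proof (rule char_tendsto_of_mgf_tendsto_positive[OF _ A_sym])
      show "p n j \<ge> 0" for n j
        unfolding p_def by (rule bounded_random_vector.pr_nonneg[OF Y])
      show "(\<lambda>n. \<Sum>j | \<forall>i. j $ i \<le> b n. p n j * exp (\<tau> * (a \<bullet> x n j))) \<longlonglongrightarrow> exp (\<tau>\<^sup>2 * (a \<bullet> (A *v a)) / 2)"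
        if "\<And>i. a $ i > 0" for a \<tau>
      proof -
        have "(\<integral>\<omega>. exp (\<tau> * (a \<bullet> x n (Y n \<omega>))) \<partial>M n) = (\<Sum>j | \<forall>i. j $ i \<le> b n. p n j *\<^sub>R exp (\<tau> * (a \<bullet> x n j)))" for n
          by (rule integral)
        then show ?thesis
          using scaled_mgf_tendsto_gaussian[OF Y stable s A that, of \<tau>] by (simp add: x_def)
      qed
    qed
    moreover have "(\<integral>\<omega>. iexp (\<theta> \<bullet> x n (Y n \<omega>)) \<partial>M n) = (\<Sum>j | \<forall>i. j $ i \<le> b n. p n j *\<^sub>R iexp (\<theta> \<bullet> x n j))" for n
      by (rule integral)
    ultimately show "(\<lambda>n. \<integral>\<omega>. iexp (\<theta> \<bullet> x n (Y n \<omega>)) \<partial>M n) \<longlonglongrightarrow> (\<integral>y. iexp (\<theta> \<bullet> y) \<partial>centred_gaussian A)"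
      unfolding char_centred_gaussian[OF B] by (simp add: scaleR_conv_of_real)
  next
    fix \<eta> :: real assume "\<eta> > 0"
    have moment: "(\<integral>\<omega>. (x n (Y n \<omega>) $ i)\<^sup>2 \<partial>M n) = C n $ i $ i / (s n)\<^sup>2" for n i
    proof -
      have "(\<integral>\<omega>. (x n (Y n \<omega>) $ i)\<^sup>2 \<partial>M n) = (\<Sum>j | \<forall>i. j $ i \<le> b n. p n j *\<^sub>R (x n j $ i)\<^sup>2)"
        by (rule integral)
      then show ?thesis
        unfolding C_def bounded_random_vector.covariance_matrix_component[OF Y] p
        by (simp add: x_def power_mult_distrib power_divide power2_eq_square sum_divide_distrib)
    qed
    have "\<exists>K. \<forall>n. C n $ i $ i / (s n)\<^sup>2 \<le> K" for i
      using convergent_imp_Bseq[OF convergentI[OF C_lim[of i i]]] 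
      unfolding Bseq_def by (metis abs_le_D1 real_norm_def)
    then obtain K where K: "\<And>i n. C n $ i $ i / (s n)\<^sup>2 \<le> K i"
      by metis
    have "K i \<le> (\<Sum>i\<in>UNIV. \<bar>K i\<bar>)" for i
      by (rule order_trans[OF abs_ge_self]) (rule member_le_sum, auto)
    then have "(\<integral>\<omega>. (x n (Y n \<omega>) $ i)\<^sup>2 \<partial>M n) \<le> (\<Sum>i\<in>UNIV. \<bar>K i\<bar>)" for n i
      unfolding moment using K order_trans by blast
    then show "\<forall>\<^sub>F R in at_top. \<forall>n. measure (M n) {\<omega> \<in> space (M n). \<exists>i. R < \<bar>x n (Y n \<omega>) $ i\<bar>} \<le> \<eta>"
      by (rule tight_of_second_moments[OF M X bounded_random_vector.integrable_Y[OF Y] _ \<open>\<eta> > 0\<close>])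
  qed
  then show ?thesis
    by (simp add: x_def)
qed

theorem corollary3:
  fixes \<epsilon> :: real
    and M :: "nat \<Rightarrow> 'a measure"
    and Y :: "nat \<Rightarrow> 'a \<Rightarrow> nat ^ 'k"
    and s :: "nat \<Rightarrow> real"
    and A :: "real ^ 'k ^ 'k"
  assumes "\<epsilon> > 0"
    and "\<And>n. n \<ge> 1 \<Longrightarrow> prob_space (M n)"
    and "\<And>n. n \<ge> 1 \<Longrightarrow> Y n \<in> measurable (M n) (count_space UNIV)"
    and "\<And>n \<omega> i. n \<ge> 1 \<Longrightarrow> \<omega> \<in> space (M n) \<Longrightarrow> Y n \<omega> $ i \<in> {1..n}"
    and "\<And>n. n \<ge> 1 \<Longrightarrow> real_stable (prob_gen_fun n (M n) (Y n))"
    and "\<And>n. n \<ge> 1 \<Longrightarrow> s n > real n powr \<epsilon>"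
    and "(\<lambda>n. (1 / (s n)\<^sup>2) *\<^sub>R covariance_matrix (M n) (\<lambda>\<omega>. real_vec (Y n \<omega>))) \<longlonglongrightarrow> A"
  shows "converges_in_distribution M
           (\<lambda>n \<omega>. (1 / s n) *\<^sub>R (real_vec (Y n \<omega>) - mean (M n) (\<lambda>\<omega>. real_vec (Y n \<omega>))))
           (centred_gaussian A)"
proof -
  \<comment> \<open>the hypotheses say nothing about \<open>n = 0\<close>, and the limit does not depend on it\<close>
  have "converges_in_distribution (\<lambda>n. M (Suc n))
           (\<lambda>n \<omega>. (1 / s (Suc n)) *\<^sub>R (real_vec (Y (Suc n) \<omega>) - mean (M (Suc n)) (\<lambda>\<omega>. real_vec (Y (Suc n) \<omega>))))
           (centred_gaussian A)"
  proof (rule real_stable_central_limit[where b = Suc])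
    fix n
    show "bounded_random_vector (M (Suc n)) (Y (Suc n)) (Suc n)"
      using assms(2,3)[of "Suc n"] assms(4)[of "Suc n"]
      by (auto simp: bounded_random_vector_def bounded_random_vector_axioms_def)
    show "real_stable (prob_gen_fun (Suc n) (M (Suc n)) (Y (Suc n)))"
      by (rule assms(5)) simp
    show "s (Suc n) > 0"
      using assms(6)[of "Suc n"] powr_ge_zero[of "real (Suc n)" \<epsilon>] by linarith
  next
    have "filterlim (\<lambda>n. real (Suc n) powr \<epsilon>) at_top sequentially"
      using \<open>\<epsilon> > 0\<close> by real_asymp
    then show "filterlim (\<lambda>n. s (Suc n)) at_top sequentially"
      by (rule filterlim_at_top_mono) (use assms(6)[of "Suc _"] in \<open>auto intro!: always_eventually less_imp_le\<close>)
    show "(\<lambda>n. (1 / (s (Suc n))\<^sup>2) *\<^sub>R covariance_matrix (M (Suc n)) (\<lambda>\<omega>. real_vec (Y (Suc n) \<omega>))) \<longlonglongrightarrow> A"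
      using assms(7) by (rule LIMSEQ_Suc)
  qed
  then show ?thesis
    unfolding converges_in_distribution_def by (blast intro: LIMSEQ_imp_Suc)
qed

end
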